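(* Let $m,n\ge 1$ be integers. The map $\Psi\colon\mathrm{Tam}_n(m)\to\mathrm{ShNC}^{(m)}(n)$ is a bijection satisfying \[\Psi\circ\mathrm{Row}=\mathrm{Rot}\circ\Psi.\]
   Context: Intervals are integer intervals: $[a,b]=\{a,\dots,b\}$ (empty if $a>b$), $[b]=[1,b]$. Vectors are indexed from $0$. $m$-Tamari lattice. Let $\ell=(m+1)n$. $\mathrm{Tam}_n(m)$ is the set of integer vectors $\mathsf b=(\mathsf b_0,\dots,\mathsf b_\ell)$ such that (I) $\mathsf b_{(m+1)k}=k$ for all $k\in[0,n]$; (II) $s+1\le \mathsf b_{(m+1)s+t}\le n$ for all $s\in[0,n-1]$, $t\in[m+1]$; (III) if $\mathsf b_i=k$, then $\mathsf b_j\le k$ for all $j\in[i+1,(m+1)k]$. It is ordered componentwise; it is a finite semidistributive lattice whose meet is the componentwise minimum. Rowmotion on a finite semidistributive lattice $L$. An element $j$ is join-irreducible if it covers exactly one element, denoted $j_*$; for such $j$, the set $\{z\in L:z\wedge j=j_*\}$ has a maximum, denoted $\kappa(j)$. For each cover relation $x\lessdot y$ there is a unique join-irreducible $j_{xy}$ with $j_{xy}\le y$ and $\kappa(j_{xy})\ge x$. Put $\mathcal D(z)=\{j_{xz}:x\lessdot z\}$ and $\mathcal U(z)=\{j_{zy}:z\lessdot y\}$. For each $x\in L$ there is a unique element $\mathrm{Row}(x)\in L$ with $\mathcal U(\mathrm{Row}(x))=\mathcal D(x)$; this defines a bijection $\mathrm{Row}\colon L\to L$. Noncrossing partitions. Two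 distinct blocks $B_1,B_2$ of a set partition of a totally ordered set form a crossing if there are $i_1,j_1\in B_1$, $i_2,j_2\in B_2$ with $i_1<i_2<j_1<j_2$ or $i_1>i_2>j_1>j_2$; a partition is noncrossing if no two distinct blocks form a crossing. $\mathrm{ShNC}^{(m)}(n)$ is the set of noncrossing partitions of $[(m+1)n]$ having exactly $mn+1$ blocks and such that $i\equiv j\pmod{m+1}$ whenever $i,j$ lie in the same block. $\mathrm{Rot}$ is the rotation operator: $i$ and $j$ lie in the same block of $\rho$ iff $i-1$ and $j-1$ (taken modulo $(m+1)n$ in $[(m+1)n]$) lie in the same block of $\mathrm{Rot}(\rho)$. The map $\Psi$. Let $\mathsf b\in\mathrm{Tam}_n(m)$. Let $\Delta(\mathsf b)=\{i\in[0,\ell-1]:\mathsf b_i>\mathsf b_{i+1}\}$ (it contains no multiple of $m+1$). An index $i\in[\ell]$ is $k$-initial in $\mathsf b$ if $\mathsf b_i=k$ and $\mathsf b_j\ne k$ for all $j\in[0,i-1]$. Define $\varphi_{\mathsf b}\colon[\ell]\to[\ell]\cup\{\emptyset\}$ as follows: (1) if $i<\ell$ is a multiple of $m+1$ and $i+1$ is $k$-initial in $\mathsf b$ for some $k$, then $\varphi_{\mathsf b}(i)=(m+1)k$; (2) if $i\in\Delta(\mathsf b)$, then $\varphi_{\mathsf b}(i)$ is the smallest $j\in[\ell]$ with $j>i$, $j\equiv i\pmod{m+1}$ and $\mathsf b_j=\mathsf b_i$ (such $j$ exists); (3) otherwise $\varphi_{\mathsf b}(i)=\emptyset$. Then $\Psi(\mathsf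 b)$ is the unique set partition of $[\ell]$ such that for all $i\in[\ell]$: $\varphi_{\mathsf b}(i)=\emptyset$ iff $i$ is the largest element of its block; and if $\varphi_{\mathsf b}(i)\ne\emptyset$, then $\varphi_{\mathsf b}(i)$ is the successor of $i$, i.e. the smallest element larger than $i$ in the block of $i$. One has $\Psi(\mathsf b)\in\mathrm{ShNC}^{(m)}(n)$. *)

theory Defs
  imports
    "HOL-Algebra.Lattice"
    "HOL-Library.Disjoint_Sets"
    "HOL-Number_Theory.Cong"
begin

section \<open>Rowmotion on a finite semidistributive lattice\<close>

text \<open>
  The definite descriptions below are meaningful for finite semidistributive lattices, where the
  objects described exist and are unique.
\<close>

definition covers :: "('a, 'b) gorder_scheme \<Rightarrow> 'a \<Rightarrow> 'a \<Rightarrow> bool" where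
  "covers L x y \<longleftrightarrow> x \<in> carrier L \<and> y \<in> carrier L \<and> x \<sqsubset>\<^bsub>L\<^esub> y \<and>
     \<not> (\<exists>z \<in> carrier L. x \<sqsubset>\<^bsub>L\<^esub> z \<and> z \<sqsubset>\<^bsub>L\<^esub> y)"

definition join_irreducible :: "('a, 'b) gorder_scheme \<Rightarrow> 'a \<Rightarrow> bool" where
  "join_irreducible L j \<longleftrightarrow> j \<in> carrier L \<and> (\<exists>!x. covers L x j)"

definition lower_star :: "('a, 'b) gorder_scheme \<Rightarrow> 'a \<Rightarrow> 'a" where
  "lower_star L j = (THE x. covers L x j)"

definition kappa :: "('a, 'b) gorder_scheme \<Rightarrow> 'a \<Rightarrow> 'a" where
  "kappa L j = (THE k. greatest L k {z \<in> carrier L. z \<sqinter>\<^bsub>L\<^esub> j = lower_star L j})"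

text \<open>The label $j_{xy}$ of a cover relation $x \lessdot y$.\<close>

definition cover_label :: "('a, 'b) gorder_scheme \<Rightarrow> 'a \<Rightarrow> 'a \<Rightarrow> 'a" where
  "cover_label L x y = (THE j. join_irreducible L j \<and> j \<sqsubseteq>\<^bsub>L\<^esub> y \<and> x \<sqsubseteq>\<^bsub>L\<^esub> kappa L j)"

definition down_labels :: "('a, 'b) gorder_scheme \<Rightarrow> 'a \<Rightarrow> 'a set" where
  "down_labels L z = {cover_label L x z | x. covers L x z}"

definition up_labels :: "('a, 'b) gorder_scheme \<Rightarrow> 'a \<Rightarrow> 'a set" where
  "up_labels L z = {cover_label L z y | y. covers L z y}"

definition rowmotion :: "('a, 'b) gorder_scheme \<Rightarrow> 'a \<Rightarrow> 'a" where
  "rowmotion L x = (THE y. y \<in> carrier L \<and> up_labels L y = down_labels L x)"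

section \<open>The m-Tamari lattice\<close>

text \<open>
  Vectors are lists indexed from 0.  Natural-number entries lose nothing: conditions (I) and (II)
  determine or bound below by 1 every entry of an integer vector, so no entry can be negative.
\<close>

definition tamari_vectors :: "nat \<Rightarrow> nat \<Rightarrow> nat list set" where
  "tamari_vectors m n = {b. length b = (m + 1) * n + 1 \<and>
     (\<forall>k \<in> {0..n}. b ! ((m + 1) * k) = k) \<and>
     (\<forall>s \<in> {0..<n}. \<forall>t \<in> {1..m + 1}.
        s + 1 \<le> b ! ((m + 1) * s + t) \<and> b ! ((m + 1) * s + t) \<le> n) \<and>
     (\<forall>i \<in> {0..(m + 1) * n}. \<forall>j \<in> {i + 1..(m + 1) * (b ! i)}. b ! j \<le> b ! i)}"

definition tamari_lattice :: "nat \<Rightarrow> nat \<Rightarrow> nat list gorder" where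
  "tamari_lattice m n = \<lparr>carrier = tamari_vectors m n, eq = (=), le = list_all2 (\<le>)\<rparr>"

section \<open>Noncrossing partitions\<close>

definition crossing :: "'a::linorder set \<Rightarrow> 'a set \<Rightarrow> bool" where
  "crossing B1 B2 \<longleftrightarrow> (\<exists>i1 \<in> B1. \<exists>j1 \<in> B1. \<exists>i2 \<in> B2. \<exists>j2 \<in> B2.
     (i1 < i2 \<and> i2 < j1 \<and> j1 < j2) \<or> (i1 > i2 \<and> i2 > j1 \<and> j1 > j2))"

definition noncrossing :: "'a::linorder set set \<Rightarrow> bool" where
  "noncrossing P \<longleftrightarrow> (\<forall>B1 \<in> P. \<forall>B2 \<in> P. B1 \<noteq> B2 \<longrightarrow> \<not> crossing B1 B2)"

definition ShNC :: "nat \<Rightarrow> nat \<Rightarrow> nat set set set" where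
  "ShNC m n = {P. partition_on {1..(m + 1) * n} P \<and> noncrossing P \<and> card P = m * n + 1 \<and>
     (\<forall>B \<in> P. \<forall>i \<in> B. \<forall>j \<in> B. [i = j] (mod (m + 1)))}"

definition cyclic_pred :: "nat \<Rightarrow> nat \<Rightarrow> nat" where
  "cyclic_pred N i = (if i = 1 then N else i - 1)"

definition Rot :: "nat \<Rightarrow> nat \<Rightarrow> nat set set \<Rightarrow> nat set set" where
  "Rot m n P = (\<lambda>B. cyclic_pred ((m + 1) * n) ` B) ` P"

section \<open>The map $\Psi$\<close>

definition descents :: "nat \<Rightarrow> nat \<Rightarrow> nat list \<Rightarrow> nat set" where
  "descents m n b = {i \<in> {0..<(m + 1) * n}. b ! i > b ! (i + 1)}"

definition k_initial :: "nat list \<Rightarrow> nat \<Rightarrow> nat \<Rightarrow> bool" where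
  "k_initial b k i \<longleftrightarrow> b ! i = k \<and> (\<forall>j \<in> {0..<i}. b ! j \<noteq> k)"

text \<open>
  In the first case, the only \<open>k\<close> for which \<open>i + 1\<close> can be \<open>k\<close>-initial is \<open>b ! (i + 1)\<close>.
  \<open>None\<close> stands for the value $\emptyset$.
\<close>

definition phi :: "nat \<Rightarrow> nat \<Rightarrow> nat list \<Rightarrow> nat \<Rightarrow> nat option" where
  "phi m n b i =
     (if i < (m + 1) * n \<and> (m + 1) dvd i \<and> (\<exists>k. k_initial b k (i + 1))
        then Some ((m + 1) * b ! (i + 1))
      else if i \<in> descents m n b
        then Some (LEAST j. j \<in> {1..(m + 1) * n} \<and> i < j \<and> [j = i] (mod (m + 1)) \<and> b ! j = b ! i)
      else None)"

definition is_successor :: "nat set \<Rightarrow> nat \<Rightarrow> nat \<Rightarrow> bool" where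
  "is_successor B i j \<longleftrightarrow> j \<in> B \<and> i < j \<and> (\<forall>x \<in> B. i < x \<longrightarrow> j \<le> x)"

definition Psi :: "nat \<Rightarrow> nat \<Rightarrow> nat list \<Rightarrow> nat set set" where
  "Psi m n b = (THE P. partition_on {1..(m + 1) * n} P \<and>
     (\<forall>B \<in> P. \<forall>i \<in> B.
        (phi m n b i = None \<longleftrightarrow> (\<forall>x \<in> B. x \<le> i)) \<and>
        (\<forall>j. phi m n b i = Some j \<longrightarrow> is_successor B i j)))"

end

theory Submission
  imports Defs
begin

text \<open>
  Write $M = m + 1$ and $\ell = Mn$. Lowering $\mathsf b$ at a descent $i$ to the value $v$, where
  $Mv + 1$ is the next position after $i$ carrying the value $\mathsf b_i$, yields exactly the
  elements covered by $\mathsf b$, and the label of this cover is the join-irreducible determined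
  by $(i, v + 1)$. Dually, the labels of the upper covers of $\mathsf y$ are given by the pairs
  $(i, \mathsf y_i + 1)$ where $M \nmid i$, $\mathsf y_i < n$ and $i$ is the first occurrence of
  its value. So $\mathrm{Row}(\mathsf b)$ turns the descents of $\mathsf b$ into first occurrences
  of values.

  Both sides of $\Psi$ are determined by a set of positions: $\mathsf b$ by the first occurrences
  of its $n$ values, and $\rho \in \mathrm{ShNC}^{(m)}(n)$ by the $n - 1$ positions that are not
  the largest of their block. These sets are ballot sequences (they are the block minima of the
  Kreweras complement of $\rho$, whose blocks all have size $M$), and under $\Psi$ they correspond
  by the shift $i \mapsto i + 1$. Hence $\Psi$ is bijective, and it intertwines
  rowmotion and rotation as soon as the position sets of $\mathrm{Rot}(\Psi(\mathsf b))$ and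
  $\Psi(\mathrm{Row}(\mathsf b))$ agree; being of equal size, one inclusion suffices.
\<close>

section \<open>Partitions determined by a successor function\<close>

text \<open>Why the shift becomes a rotation: away from the multiples of \<open>M\<close>,
  \<open>i\<close> is a descent of \<open>b\<close> exactly if \<open>i + 1\<close> is a first
  occurrence in \<open>b\<close>, that is, if \<open>i\<close> is not the largest of its block in
  \<open>Psi m n b\<close>. Rowmotion turns this same \<open>i\<close> into a first occurrence, so
  for \<open>i > 1\<close> the position \<open>i - 1\<close> is not the largest of its block in the
  image. Two kinds of positions escape this argument. Multiples of \<open>M\<close> are neither
  descents nor ascents; for them, an earlier occurrence of their value is excluded by the gap it
  would create. The first occurrence of \<open>n\<close> cannot be raised, hence carries no label;
  it comes from the wrap-around, where 1 becomes \<open>M * n\<close> and the largest element of the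
  block of 1, unless it is 1 itself, stops being the largest of its block. Comparing position sets
  avoids computing the arcs of the image. Labels, \<open>kappa\<close>, \<open>rowmotion\<close> and
  \<open>Psi\<close> are definite descriptions, so each is resolved by an explicit witness together
  with a uniqueness proof.\<close>

definition follows :: "(nat \<Rightarrow> nat option) \<Rightarrow> nat set \<Rightarrow> nat set set \<Rightarrow> bool" where
  "follows f A P \<longleftrightarrow> partition_on A P \<and>
     (\<forall>B \<in> P. \<forall>i \<in> B. (f i = None \<longleftrightarrow> (\<forall>x \<in> B. x \<le> i)) \<and>
        (\<forall>j. f i = Some j \<longrightarrow> is_successor B i j))"

lemma follows_reach:
  assumes P: "follows f A P" and B: "B \<in> P" "i \<in> B" "j \<in> B" "i \<le> j"
  shows "(i, j) \<in> {(i, j). f i = Some j}\<^sup>*"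
  using B(2,4)
proof (induction "j - i" arbitrary: i rule: less_induct)
  case less
  show ?case
  proof (cases "i = j")
    case False
    then have "i < j" using less by simp
    then have "f i \<noteq> None" using P B less unfolding follows_def by (meson leD)
    then obtain k where k: "f i = Some k" by blast
    then have "is_successor B i k" using P B less unfolding follows_def by blast
    then have "k \<in> B" "i < k" "k \<le> j" using B \<open>i < j\<close> unfolding is_successor_def by auto
    then have "(k, j) \<in> {(i, j). f i = Some j}\<^sup>*" using less(1)[of k] by simp
    then show ?thesis using k by (auto intro: converse_rtrancl_into_rtrancl)
  qed simp
qed

lemma reach_follows:
  assumes P: "follows f A P" and B: "B \<in> P" "i \<in> B" and R: "(i, j) \<in> {(i, j). f i = Some j}\<^sup>*"
  shows "j \<in> B"
  using R
proof (induction rule: rtrancl_induct)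
  case (step y z)
  then show ?case using P B unfolding follows_def is_successor_def by auto
qed (fact B)

text \<open>A block consists of the positions joined to one of its elements by iterating
  \<open>f\<close> forwards or backwards, a description free of the partition. It serves twice: with
  \<open>phi\<close>, to evaluate \<open>Psi\<close>, and with a successor rule read off from the
  openers, to show that these determine an element of \<open>ShNC m n\<close>.\<close>

lemma follows_unique:
  assumes "follows f A P" "follows f A Q" shows "P = Q"
proof -
  have *: "P \<subseteq> Q" if P: "follows f A P" and Q: "follows f A Q" for P Q
  proof
    fix B assume B: "B \<in> P"
    have pP: "partition_on A P" and pQ: "partition_on A Q" using P Q unfolding follows_def by auto
    then obtain i where i: "i \<in> B" "i \<in> A" using B by (metis partition_onD1 partition_onD3 UnionI all_not_in_conv)
    then obtain C where C: "C \<in> Q" "i \<in> C" using pQ partition_onD1 by blast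
    have "j \<in> C \<longleftrightarrow> j \<in> B" for j
    proof
      assume j: "j \<in> B"
      show "j \<in> C"
      proof (cases "i \<le> j")
        case True
        then show ?thesis using follows_reach[OF P B i(1) j] reach_follows[OF Q C] by blast
      next
        case False
        then have R: "(j, i) \<in> {(i, j). f i = Some j}\<^sup>*" using follows_reach[OF P B j i(1)] by simp
        have "j \<in> A" using pP B j partition_onD1 by blast
        then obtain D where D: "D \<in> Q" "j \<in> D" using pQ partition_onD1 by blast
        then have "i \<in> D" using reach_follows[OF Q D R] by simp
        then have "D = C" using C D pQ by (metis partition_onD2 disjointD disjoint_iff)
        then show ?thesis using D by simp
      qed
    next
      assume j: "j \<in> C"
      show "j \<in> B"
      proof (cases "i \<le> j")
        case True
        then show ?thesis using follows_reach[OF Q C j] reach_follows[OF P B i(1)] by blast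
      next
        case False
        then have R: "(j, i) \<in> {(i, j). f i = Some j}\<^sup>*" using follows_reach[OF Q C(1) j C(2)] by simp
        have "j \<in> A" using pQ C j partition_onD1 by blast
        then obtain D where D: "D \<in> P" "j \<in> D" using pP partition_onD1 by blast
        then have "i \<in> D" using reach_follows[OF P D R] by simp
        then have "D = B" using B i D pP by (metis partition_onD2 disjointD disjoint_iff)
        then show ?thesis using D by simp
      qed
    qed
    then have "C = B" by blast
    then show "B \<in> Q" using C by simp
  qed
  show ?thesis using *[of P Q] *[of Q P] assms by blast
qed

text \<open>The blocks are the classes of comparability along \<open>f\<close>-paths. Comparability
  is transitive because paths neither branch (\<open>f\<close> is a function) nor merge
  (\<open>f\<close> is injective where defined).\<close>

lemma follows_exists:
  assumes dom: "\<And>i j. i \<in> A \<Longrightarrow> f i = Some j \<Longrightarrow> j \<in> A \<and> i < j"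
    and inj: "\<And>i j k. i \<in> A \<Longrightarrow> j \<in> A \<Longrightarrow> f i = Some k \<Longrightarrow> f j = Some k \<Longrightarrow> i = j"
  obtains P where "follows f A P"
proof -
  define R where "R = {(i, j). i \<in> A \<and> f i = Some j}"
  define E where "E = {(i, j). i \<in> A \<and> j \<in> A \<and> ((i, j) \<in> R\<^sup>* \<or> (j, i) \<in> R\<^sup>*)}"
  have sv: "single_valued R" unfolding R_def single_valued_def by auto
  have svc: "single_valued (R\<inverse>)" unfolding R_def single_valued_def using inj by auto
  have fork: "(b, c) \<in> R\<^sup>* \<or> (c, b) \<in> R\<^sup>*" if "(a, b) \<in> R\<^sup>*" "(a, c) \<in> R\<^sup>*" for a b c
    using single_valued_confluent[OF sv] that by blast
  have join: "(b, c) \<in> R\<^sup>* \<or> (c, b) \<in> R\<^sup>*" if "(b, a) \<in> R\<^sup>*" "(c, a) \<in> R\<^sup>*" for a b c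
    using single_valued_confluent[OF svc, of a b c] that unfolding rtrancl_converse by blast
  have eq: "equiv A E"
  proof (rule equivI)
    show "E \<subseteq> A \<times> A" unfolding E_def by auto
    show "refl_on A E" unfolding E_def refl_on_def by auto
    show "sym E" unfolding E_def sym_def by auto
    show "trans E" unfolding trans_def
    proof (intro allI impI)
      fix a b c assume "(a, b) \<in> E" "(b, c) \<in> E"
      then have A: "a \<in> A" "c \<in> A"
        and R: "(a, b) \<in> R\<^sup>* \<or> (b, a) \<in> R\<^sup>*" "(b, c) \<in> R\<^sup>* \<or> (c, b) \<in> R\<^sup>*"
        unfolding E_def by auto
      have "(a, c) \<in> R\<^sup>* \<or> (c, a) \<in> R\<^sup>*"
        using R fork[of b a c] join[of a b c] rtrancl_trans[of a b R c] rtrancl_trans[of c b R a] by blast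
      then show "(a, c) \<in> E" unfolding E_def using A by simp
    qed
  qed
  have mono: "i \<le> j" if "(i, j) \<in> R\<^sup>*" for i j
    using that
  proof induction
    case (step y z)
    then show ?case using dom[of y z] unfolding R_def by auto
  qed simp
  have step: "i = j \<or> (\<exists>k. f i = Some k \<and> (k, j) \<in> R\<^sup>*)" if "(i, j) \<in> R\<^sup>*" for i j
    using that by (cases rule: converse_rtranclE) (auto simp: R_def)
  have "follows f A (A // E)" unfolding follows_def
  proof (intro conjI ballI allI impI)
    show "partition_on A (A // E)" using partition_on_quotient eq by blast
    fix B i assume B: "B \<in> A // E" "i \<in> B"
    then have iA: "i \<in> A" using eq by (meson in_quotient_imp_subset subset_eq)
    have mem: "x \<in> B \<longleftrightarrow> (i, x) \<in> E" for x
    proof -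
      have "B = E `` {i}" using B eq by (metis quotientE equiv_class_eq_iff Image_singleton_iff)
      then show ?thesis by simp
    qed
    have succ: "is_successor B i j" if j: "f i = Some j" for j
      unfolding is_successor_def
    proof (intro conjI ballI impI)
      have "(i, j) \<in> R" using iA j R_def by simp
      then show "j \<in> B" unfolding mem E_def using dom[OF iA j] iA by auto
      show "i < j" using dom[OF iA j] by simp
      fix x assume x: "x \<in> B" "i < x"
      then have "(i, x) \<in> R\<^sup>*" unfolding mem E_def using mono[of x i] by auto
      then have "(j, x) \<in> R\<^sup>*" using step[of i x] x j by auto
      then show "j \<le> x" by (rule mono)
    qed
    then show "is_successor B i j" if "f i = Some j" for j using that .
    show "f i = None \<longleftrightarrow> (\<forall>x \<in> B. x \<le> i)"
    proof
      assume N: "f i = None"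
      show "\<forall>x \<in> B. x \<le> i"
      proof
        fix x assume "x \<in> B"
        then have "(i, x) \<in> R\<^sup>* \<or> (x, i) \<in> R\<^sup>*" unfolding mem E_def by simp
        then show "x \<le> i" using step[of i x] mono[of x i] N by auto
      qed
    next
      assume H: "\<forall>x \<in> B. x \<le> i"
      show "f i = None"
      proof (rule ccontr)
        assume "f i \<noteq> None"
        then obtain j where "is_successor B i j" using succ by auto
        then show False using H unfolding is_successor_def by auto
      qed
    qed
  qed
  then show ?thesis using that by blast
qed

lemma partition_block_eq:
  "partition_on A P \<Longrightarrow> B \<in> P \<Longrightarrow> C \<in> P \<Longrightarrow> x \<in> B \<Longrightarrow> x \<in> C \<Longrightarrow> B = C"
  by (metis partition_onD2 disjointD disjoint_iff)

text \<open>Crossings need only be excluded between arcs from an element to its successor: given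
  \<open>p < q < r < s\<close>, some arc of \<open>B\<close> passes over \<open>q\<close>, and the
  arc of \<open>C\<close> from its last element under that arc must leave it.\<close>

lemma follows_noncrossing:
  assumes P: "follows f A P"
    and arcs: "\<And>i j i' j'. i \<in> A \<Longrightarrow> i' \<in> A \<Longrightarrow> f i = Some j \<Longrightarrow> f i' = Some j' \<Longrightarrow> i < i' \<Longrightarrow> i' < j \<Longrightarrow> j' \<le> j"
  shows "noncrossing P"
proof -
  have pt: "partition_on A P" using P unfolding follows_def by simp
  have no: "False" if B: "B \<in> P" and C: "C \<in> P" and ne: "B \<noteq> C"
    and mem: "p \<in> B" "q \<in> C" "r \<in> B" "s \<in> C" and lt: "p < q" "q < r" "r < s" for B C p q r s
  proof -
    have sub: "B \<subseteq> A" "C \<subseteq> A" using B C pt partition_onD1 by blast+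
    define x where "x = Max {x \<in> B. x < q}"
    have fin: "finite {x \<in> B. x < q}" by simp
    have "x \<in> {x \<in> B. x < q}" unfolding x_def using mem lt by (intro Max_in[OF fin]) auto
    then have x: "x \<in> B" "x < q" by auto
    have xmax: "y \<le> x" if "y \<in> B" "y < q" for y
      using Max_ge[OF fin] that unfolding x_def by simp
    have "f x \<noteq> None" using P B x mem lt unfolding follows_def by (meson less_trans leD)
    then obtain y where y: "f x = Some y" by blast
    then have sy: "is_successor B x y" using P B x unfolding follows_def by blast
    then have yB: "y \<in> B" "x < y" "y \<le> r" using mem x lt unfolding is_successor_def by auto
    have "\<not> y < q" using xmax[of y] yB by auto
    moreover have "y \<noteq> q" using partition_block_eq[OF pt B C] yB mem ne by auto
    ultimately have qy: "q < y" by simp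
    define u where "u = Max {u \<in> C. u < y}"
    have fin: "finite {u \<in> C. u < y}" by simp
    have umax: "v \<le> u" if "v \<in> C" "v < y" for v
      using Max_ge[OF fin] that unfolding u_def by simp
    have "u \<in> {u \<in> C. u < y}" unfolding u_def using mem qy by (intro Max_in[OF fin]) auto
    then have u: "u \<in> C" "u < y" "q \<le> u" using umax[of q] mem qy by auto
    have "u < s" using u yB lt by simp
    then have "f u \<noteq> None" using P C u mem unfolding follows_def by (meson leD)
    then obtain v where v: "f u = Some v" by blast
    then have sv: "is_successor C u v" using P C u unfolding follows_def by blast
    then have vC: "v \<in> C" "u < v" unfolding is_successor_def by auto
    have "\<not> v < y" using umax[of v] vC by auto
    moreover have "v \<noteq> y" using partition_block_eq[OF pt B C] yB vC ne by auto
    ultimately have "y < v" by simp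
    moreover have "v \<le> y" using arcs[of x u y v] sub x u y v by auto
    ultimately show False by simp
  qed
  show ?thesis unfolding noncrossing_def crossing_def using no by metis
qed

definition openers :: "nat set set \<Rightarrow> nat set" where
  "openers P = {i. \<exists>B \<in> P. i \<in> B \<and> (\<exists>x \<in> B. i < x)}"

lemma openers_follows:
  assumes "follows f A P" shows "openers P = {i \<in> A. f i \<noteq> None}"
proof -
  have pt: "partition_on A P" using assms unfolding follows_def by simp
  have "f i \<noteq> None \<longleftrightarrow> (\<exists>x \<in> B. i < x)" if "B \<in> P" "i \<in> B" for B i
    using assms that unfolding follows_def by (metis not_le)
  then show ?thesis unfolding openers_def using partition_onD1[OF pt] by blast
qed

lemma card_openers:
  assumes pt: "partition_on A P" and fin: "finite A"
  shows "card P + card (openers P) = card A"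
proof -
  have sub: "openers P \<subseteq> A" unfolding openers_def using partition_onD1[OF pt] by blast
  have finB: "finite B" "B \<noteq> {}" if "B \<in> P" for B
    using that fin pt partition_onD1[OF pt] partition_onD3[OF pt] by (auto intro: finite_subset)
  have "inj_on Max P"
    by (rule inj_onI) (use finB Max_in partition_block_eq[OF pt] in metis)
  moreover have "Max ` P = A - openers P"
  proof (rule Set.set_eqI, rule iffI)
    fix x assume "x \<in> Max ` P"
    then obtain B where B: "B \<in> P" "x = Max B" by blast
    then have xB: "x \<in> B" using finB Max_in by blast
    then have "x \<in> A" using B partition_onD1[OF pt] by blast
    moreover have "x \<notin> openers P"
    proof
      assume "x \<in> openers P"
      then obtain C y where C: "C \<in> P" "x \<in> C" "y \<in> C" "x < y" unfolding openers_def by blast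
      then have "C = B" using partition_block_eq[OF pt] B xB by blast
      then show False using C B finB Max_ge by (metis leD)
    qed
    ultimately show "x \<in> A - openers P" by simp
  next
    fix x assume x: "x \<in> A - openers P"
    then obtain B where B: "B \<in> P" "x \<in> B" using partition_onD1[OF pt] by blast
    then have "Max B = x" using x finB unfolding openers_def by (intro Max_eqI) (auto simp: not_less)
    then show "x \<in> Max ` P" using B by blast
  qed
  ultimately have "card P = card (A - openers P)" using card_image by metis
  then show ?thesis using card_Diff_subset[OF finite_subset[OF sub fin] sub] card_mono[OF fin sub] by simp
qed

section \<open>Cover relations of the m-Tamari lattice\<close>

text \<open>\<open>M\<close> is a parameter and not an abbreviation, so that simplification does not
  distribute products with \<open>m + 1\<close>.\<close>

locale tamari =
  fixes m n M :: nat
  assumes m_plus_1: "m + 1 = M" and M_ge_2: "M \<ge> 2" and n_pos: "n \<ge> 1"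
begin

abbreviation T where "T \<equiv> tamari_vectors m n"
abbreviation L where "L \<equiv> tamari_lattice m n"

text \<open>The ceiling of $i/M$.\<close>

definition row :: "nat \<Rightarrow> nat" where "row i = (i + m) div M"

lemma M_pos: "M > 0" using M_ge_2 by simp

text \<open>\<open>row\<close> is left adjoint to multiplication by \<open>M\<close>; the lower
  bounds \<open>i \<le> M * b ! i\<close> and \<open>row i \<le> b ! i\<close> are therefore
  interchangeable.\<close>

lemma row_le_iff: "row i \<le> k \<longleftrightarrow> i \<le> M * k"
proof -
  have "row i \<le> k \<longleftrightarrow> row i < k + 1" by auto
  also have "\<dots> \<longleftrightarrow> i + m < (k + 1) * M"
    unfolding row_def using M_pos by (simp add: div_less_iff_less_mult)
  also have "\<dots> \<longleftrightarrow> i \<le> M * k" using m_plus_1 by (auto simp: algebra_simps)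
  finally show ?thesis .
qed

lemma less_row_iff: "k < row i \<longleftrightarrow> M * k < i"
  using row_le_iff[of i k] by linarith

lemma row_mult [simp]: "row (M * k) = k"
  using row_le_iff[of "M * k"] M_pos by (metis le_antisym le_refl mult_le_cancel1)

lemma row_eq_iff: "row i = k + 1 \<longleftrightarrow> M * k < i \<and> i \<le> M * (k + 1)"
  using row_le_iff[of i "k + 1"] less_row_iff[of k i] by linarith

lemma row_mono: "i \<le> j \<Longrightarrow> row i \<le> row j"
  unfolding row_def by (simp add: div_le_mono)

lemma le_mult_row: "i \<le> M * row i"
  using row_le_iff by blast

lemma row_Suc_mult: "M dvd i \<Longrightarrow> row (i + 1) = row i + 1"
  using M_ge_2 row_mult by (auto simp: row_eq_iff[simplified] elim!: dvdE)

lemma less_mult_if_not_dvd: "\<lbrakk>\<not> M dvd i; i \<le> M * k\<rbrakk> \<Longrightarrow> i < M * k"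
  by (metis dvd_triv_left le_neq_implies_less)

lemma row_Suc_not_mult: "\<not> M dvd i \<Longrightarrow> row (i + 1) = row i"
  using less_mult_if_not_dvd[of i "row i"] row_le_iff[of "i + 1" "row i"] row_mono[of i "i + 1"] le_mult_row[of i]
  by linarith

lemma row_pos: "i > 0 \<Longrightarrow> row i > 0"
  using less_row_iff[of 0 i] by simp

text \<open>For \<open>i = M * s + t\<close> with \<open>1 \<le> t \<le> M\<close> one has
  \<open>row i = s + 1\<close>, so by adjunction the lower bound in (II) becomes
  \<open>i \<le> M * b ! i\<close>, without decomposing \<open>i\<close>.\<close>

lemma T_iff: "b \<in> T \<longleftrightarrow> length b = M * n + 1 \<and> (\<forall>k\<le>n. b ! (M * k) = k) \<and>
   (\<forall>i\<le>M * n. i \<le> M * b ! i \<and> b ! i \<le> n) \<and> (\<forall>i j. i < j \<and> j \<le> M * b ! i \<and> i \<le> M * n \<longrightarrow> b ! j \<le> b ! i)"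
  (is "_ \<longleftrightarrow> ?R")
proof -
  have *: "(\<forall>s \<in> {0..<n}. \<forall>t \<in> {1..M}. s + 1 \<le> b ! (M * s + t) \<and> b ! (M * s + t) \<le> n)
     \<longleftrightarrow> (\<forall>i\<le>M * n. i \<le> M * b ! i \<and> b ! i \<le> n)" if mult: "\<forall>k\<le>n. b ! (M * k) = k"
  proof (intro iffI allI impI ballI)
    fix i assume H: "\<forall>s \<in> {0..<n}. \<forall>t \<in> {1..M}. s + 1 \<le> b ! (M * s + t) \<and> b ! (M * s + t) \<le> n"
      and i: "i \<le> M * n"
    show "i \<le> M * b ! i \<and> b ! i \<le> n"
    proof (cases "i = 0")
      case True
      then show ?thesis using mult[rule_format, of 0] by simp
    next
      case False
      define s where "s = row i - 1"
      define t where "t = i - M * s"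
      have cs: "row i = s + 1" using False row_pos[of i] s_def by simp
      then have st: "M * s < i" "i \<le> M * (s + 1)" using row_eq_iff by auto
      have "row i \<le> n" using i row_le_iff by simp
      then have "s < n" using cs by simp
      moreover have "1 \<le> t" "i = M * s + t" using st(1) unfolding t_def by simp_all
      moreover have "t \<le> M" using st(2) unfolding t_def by simp
      ultimately have "row i \<le> b ! i \<and> b ! i \<le> n" using H cs by simp
      then show ?thesis using row_le_iff by blast
    qed
  next
    fix s t assume H: "\<forall>i\<le>M * n. i \<le> M * b ! i \<and> b ! i \<le> n"
      and s: "s \<in> {0..<n}" and t: "t \<in> {1..M}"
    have "M * (s + 1) \<le> M * n" using s by (intro mult_le_mono2) auto
    then have "M * s + t \<le> M * n" using t by (simp add: algebra_simps)
    moreover have "row (M * s + t) = s + 1" using t row_eq_iff by (auto simp: algebra_simps)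
    ultimately show "s + 1 \<le> b ! (M * s + t) \<and> b ! (M * s + t) \<le> n"
      using H row_le_iff by metis
  qed
  have nest: "(\<forall>i \<in> {0..M * n}. \<forall>j \<in> {i + 1..M * (b ! i)}. b ! j \<le> b ! i)
     \<longleftrightarrow> (\<forall>i j. i < j \<and> j \<le> M * b ! i \<and> i \<le> M * n \<longrightarrow> b ! j \<le> b ! i)"
    by (simp add: Ball_def Suc_le_eq) blast
  have mult: "(\<forall>k \<in> {0..n}. b ! (M * k) = k) \<longleftrightarrow> (\<forall>k\<le>n. b ! (M * k) = k)"
    by auto
  show ?thesis unfolding tamari_vectors_def m_plus_1 mem_Collect_eq nest mult
    using * by blast
qed

lemma T_length: "b \<in> T \<Longrightarrow> length b = M * n + 1"
  and T_mult: "b \<in> T \<Longrightarrow> k \<le> n \<Longrightarrow> b ! (M * k) = k"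
  and T_lower: "b \<in> T \<Longrightarrow> i \<le> M * n \<Longrightarrow> i \<le> M * b ! i"
  and T_upper: "b \<in> T \<Longrightarrow> i \<le> M * n \<Longrightarrow> b ! i \<le> n"
  and T_nest: "b \<in> T \<Longrightarrow> i \<le> M * n \<Longrightarrow> i < j \<Longrightarrow> j \<le> M * b ! i \<Longrightarrow> b ! j \<le> b ! i"
  by (auto simp: T_iff)

lemma T_row: "b \<in> T \<Longrightarrow> i \<le> M * n \<Longrightarrow> row i \<le> b ! i"
  using T_lower row_le_iff by blast

lemma T_less: "b \<in> T \<Longrightarrow> i \<le> M * n \<Longrightarrow> \<not> M dvd i \<Longrightarrow> i < M * b ! i"
  using T_lower less_mult_if_not_dvd by blast

lemma T_val_le: "b \<in> T \<Longrightarrow> i \<le> M * n \<Longrightarrow> M * b ! i \<le> M * n"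
  using T_upper by simp

lemma T_nest_le: "b \<in> T \<Longrightarrow> i \<le> M * n \<Longrightarrow> i \<le> j \<Longrightarrow> j \<le> M * b ! i \<Longrightarrow> b ! j \<le> b ! i"
  using T_nest le_neq_implies_less by blast

lemma T_Suc_le: "b \<in> T \<Longrightarrow> i \<le> M * n \<Longrightarrow> \<not> M dvd i \<Longrightarrow> b ! (i + 1) \<le> b ! i"
  using T_nest[of b i "i + 1"] T_less[of b i] by simp

lemma T_dvd: "b \<in> T \<Longrightarrow> i \<le> M * n \<Longrightarrow> M dvd i \<Longrightarrow> b ! i = row i"
  using T_mult M_pos by (auto elim!: dvdE)

lemma descents_iff: "i \<in> descents m n b \<longleftrightarrow> i < M * n \<and> b ! (i + 1) < b ! i"
  unfolding descents_def m_plus_1 by auto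

lemma descent_less: "i \<in> descents m n b \<Longrightarrow> i < M * n"
  by (simp add: descents_iff)

lemma descent_not_dvd: 
  assumes "b \<in> T" "i \<in> descents m n b" shows "\<not> M dvd i"
proof
  assume d: "M dvd i"
  have i: "i < M * n" "b ! (i + 1) < b ! i" using assms descents_iff by auto
  have "row (i + 1) \<le> b ! (i + 1)" using T_row assms i by simp
  then show False using row_Suc_mult[OF d] T_dvd[OF assms(1) _ d] i by simp
qed

text \<open>
  For a descent $i$: $Mv + 1$ is the next position after $i$ with the value of $i$. Because rows
  are weakly decreasing, that position starts a row, so such a $v$ always exists; and $v$ is the
  largest value to which $i$ can be lowered without violating (III).
\<close>

definition gap :: "nat list \<Rightarrow> nat \<Rightarrow> nat \<Rightarrow> bool" where
  "gap b i v \<longleftrightarrow> i \<le> M * v \<and> v < b ! i \<and> b ! (M * v + 1) = b ! i \<and>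
    (\<forall>j. i < j \<and> j \<le> M * v \<longrightarrow> b ! j < b ! i)"

lemma gap_unique: "gap b i v \<Longrightarrow> gap b i v' \<Longrightarrow> v = v'"
proof (induction v v' rule: linorder_wlog)
  case (le v v')
  show ?case
  proof (rule ccontr)
    assume "v \<noteq> v'"
    then have "M * (v + 1) \<le> M * v'" using le by (intro mult_le_mono2) auto
    then have "M * v + 1 \<le> M * v'" using M_pos by (simp add: algebra_simps)
    moreover have "i < M * v + 1" "b ! (M * v + 1) = b ! i" using le unfolding gap_def by simp_all
    ultimately show False using le(3) unfolding gap_def by (metis less_irrefl)
  qed
qed auto

lemma mult_less_imp: "v < k \<Longrightarrow> M * v + 1 \<le> M * k"
  by (simp add: M_pos Suc_leI)

lemma mult_le_imp: "M * v + 1 \<le> M * k \<Longrightarrow> v < k"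
  using M_pos by (metis Suc_eq_plus1 Suc_le_eq mult_less_cancel1)

lemma gap_exists:
  assumes b: "b \<in> T" and i: "i \<in> descents m n b"
  obtains v where "gap b i v"
proof -
  have nd: "\<not> M dvd i" using descent_not_dvd assms by blast
  have i': "i < M * n" "b ! (i + 1) < b ! i" using i descents_iff by auto
  define Q where "Q p \<longleftrightarrow> i < p \<and> b ! p = b ! i" for p
  have Q: "Q (M * b ! i)" unfolding Q_def using T_less[OF b _ nd] T_mult[OF b] T_upper[OF b] i' by simp
  define p where "p = (LEAST p. Q p)"
  have p: "Q p" "p \<le> M * b ! i" unfolding p_def using Q by (auto intro: LeastI Least_le)
  have pm: "b ! j \<noteq> b ! i" if "i < j" "j < p" for j using that not_less_Least[of j Q] unfolding p_def Q_def by auto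
  have ile: "p \<le> M * n" using p T_val_le[OF b, of i] i' by linarith
  \<comment> \<open>Otherwise \<open>p - 1\<close> lies in the row of \<open>p\<close> and carries
    at least the value of \<open>p\<close>; by nesting it carries at most that value. So
    \<open>p - 1\<close> would be an earlier recurrence or \<open>i\<close> itself, and
    \<open>i\<close> is followed by a smaller entry.\<close>
  have "M dvd (p - 1)"
  proof (rule ccontr)
    assume nd': "\<not> M dvd (p - 1)"
    have p1: "p - 1 + 1 = p" and ip: "i \<le> p - 1" "b ! p = b ! i" "p - 1 \<le> M * b ! i"
      using p unfolding Q_def by linarith+
    have "b ! p \<le> b ! (p - 1)" using T_Suc_le[OF b _ nd'] ile p1 by simp
    moreover have "b ! (p - 1) \<le> b ! i" using T_nest_le[OF b, of i "p - 1"] i' ip by simp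
    ultimately have e: "b ! (p - 1) = b ! i" using ip by linarith
    have "p - 1 < p" using p1 by linarith
    then have "p - 1 = i" using pm[of "p - 1"] e ip(1) le_neq_implies_less by metis
    then show False using p1 i' ip by simp
  qed
  then obtain v where v: "p - 1 = M * v" by blast
  then have pv: "p = M * v + 1" using p unfolding Q_def by linarith
  have "gap b i v" unfolding gap_def
  proof (intro conjI allI impI)
    show "i \<le> M * v" using pv p unfolding Q_def by simp
    show "v < b ! i" using p(2) pv mult_le_imp by simp
    show "b ! (M * v + 1) = b ! i" using p pv unfolding Q_def by simp
    fix j assume j: "i < j \<and> j \<le> M * v"
    then have "b ! j \<noteq> b ! i" using pm pv by simp
    moreover have "b ! j \<le> b ! i" using T_nest[OF b, of i j] i' j p pv by simp
    ultimately show "b ! j < b ! i" by simp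
  qed
  then show ?thesis using that by blast
qed

text \<open>An entry above \<open>v\<close> would reach as far as \<open>M * v + 1\<close> and bound
  the entry there, which equals \<open>b ! i\<close>; but entries inside the gap are smaller than
  \<open>b ! i\<close>. This keeps (III) valid after lowering \<open>i\<close> to
  \<open>v\<close>.\<close>

lemma gap_le:
  assumes b: "b \<in> T" and i: "i \<le> M * n" and g: "gap b i v" and j: "i < j" "j \<le> M * v"
  shows "b ! j \<le> v"
proof (rule ccontr)
  assume "\<not> b ! j \<le> v"
  then have "M * v + 1 \<le> M * b ! j" using mult_less_imp by simp
  moreover have "M * v \<le> M * n" using g T_upper[OF b i] unfolding gap_def
    by (intro mult_le_mono2) simp
  ultimately have "b ! (M * v + 1) \<le> b ! j" using T_nest[OF b, of j "M * v + 1"] j by linarith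
  then show False using g j unfolding gap_def by (metis leD)
qed

section \<open>The componentwise order and its lower covers\<close>

lemma le_iff: "x \<in> T \<Longrightarrow> y \<in> T \<Longrightarrow> x \<sqsubseteq>\<^bsub>L\<^esub> y \<longleftrightarrow> (\<forall>i\<le>M * n. x ! i \<le> y ! i)"
  unfolding tamari_lattice_def by (auto simp: list_all2_conv_all_nth T_length less_Suc_eq_le)

lemma carrier_L [simp]: "carrier L = T"
  by (simp add: tamari_lattice_def)

lemma eq_L [simp]: "x .=\<^bsub>L\<^esub> y \<longleftrightarrow> x = y"
  by (simp add: tamari_lattice_def)

lemma T_eqI: "x \<in> T \<Longrightarrow> y \<in> T \<Longrightarrow> (\<And>i. i \<le> M * n \<Longrightarrow> x ! i = y ! i) \<Longrightarrow> x = y"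
  by (auto intro!: nth_equalityI simp: T_length)

lemma T_antisym: "x \<in> T \<Longrightarrow> y \<in> T \<Longrightarrow> x \<sqsubseteq>\<^bsub>L\<^esub> y \<Longrightarrow> y \<sqsubseteq>\<^bsub>L\<^esub> x \<Longrightarrow> x = y"
  by (intro T_eqI) (auto simp: le_iff intro: le_antisym)

lemma less_iff: "x \<sqsubset>\<^bsub>L\<^esub> y \<longleftrightarrow> x \<sqsubseteq>\<^bsub>L\<^esub> y \<and> x \<noteq> y"
  by (simp add: lless_def)

lemma nth_update: "b \<in> T \<Longrightarrow> j \<le> M * n \<Longrightarrow> b[i := v] ! j = (if j = i then v else b ! j)"
  by (auto simp: nth_list_update T_length)

lemma update_in_T:
  assumes b: "b \<in> T" and i: "i \<le> M * n" "\<not> M dvd i" and v: "i \<le> M * v" "v \<le> n"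
    and right: "\<And>j. i < j \<Longrightarrow> j \<le> M * v \<Longrightarrow> b ! j \<le> v"
    and left: "\<And>j. j < i \<Longrightarrow> i \<le> M * b ! j \<Longrightarrow> v \<le> b ! j"
  shows "b[i := v] \<in> T"
  unfolding T_iff
proof (intro conjI allI impI)
  have [simp]: "length b = M * n + 1" using T_length b by simp
  show "length (b[i := v]) = M * n + 1" by simp
  fix k assume "k \<le> n"
  then show "b[i := v] ! (M * k) = k" using i T_mult[OF b] by (metis dvd_triv_left nth_list_update_neq)
next
  fix j assume j: "j \<le> M * n"
  then show "j \<le> M * b[i := v] ! j" and "b[i := v] ! j \<le> n" 
    using T_lower[OF b] T_upper[OF b] v by (simp_all add: nth_update[OF b])
next
  fix j k assume jk: "j < k \<and> k \<le> M * b[i := v] ! j \<and> j \<le> M * n"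
  consider "j = i" | "k = i" "j \<noteq> i" | "j \<noteq> i" "k \<noteq> i" by blast
  then show "b[i := v] ! k \<le> b[i := v] ! j"
  proof cases
    case 1 then show ?thesis using jk right T_length[OF b] i by (simp)
  next
    case 2
    then have "i \<le> M * b ! j" using jk nth_update[OF b, of j i v] by auto
    then show ?thesis using 2 jk left[of j] i nth_update[OF b] by simp
  next
    case 3 then show ?thesis using jk T_nest[OF b] by simp
  qed
qed

lemma lowered_in_T:
  assumes b: "b \<in> T" and i: "i \<in> descents m n b" and g: "gap b i v"
  shows "b[i := v] \<in> T"
proof (rule update_in_T[OF b])
  have i': "i < M * n" "b ! (i + 1) < b ! i" using i descents_iff by auto
  show "i \<le> M * n" "\<not> M dvd i" using i' descent_not_dvd b i by auto
  have vb: "v < b ! i" using g unfolding gap_def by simp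
  show "i \<le> M * v" using g unfolding gap_def by simp
  show "v \<le> n" using vb T_upper[OF b, of i] i' by simp
  show "b ! j \<le> v" if "i < j" "j \<le> M * v" for j using gap_le[OF b _ g] that i' by simp
  show "v \<le> b ! j" if "j < i" "i \<le> M * b ! j" for j using T_nest[OF b, of j i] that i' vb by simp
qed

text \<open>Take for \<open>i\<close> the last position where the vectors differ. They agree behind
  it, so \<open>i\<close> is a descent of \<open>z\<close>; and if \<open>x ! i\<close> exceeded
  \<open>v\<close>, nesting in \<open>x\<close> would bound the shared entry at
  \<open>M * v + 1\<close> by \<open>x ! i < z ! i\<close>, against the gap.\<close>

lemma below_lowered:
  assumes x: "x \<in> T" and z: "z \<in> T" and le: "x \<sqsubseteq>\<^bsub>L\<^esub> z" and ne: "x \<noteq> z"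
  obtains i v where "i \<in> descents m n z" "gap z i v" "x \<sqsubseteq>\<^bsub>L\<^esub> z[i := v]"
proof -
  have le': "x ! i \<le> z ! i" if "i \<le> M * n" for i using le le_iff x z that by simp
  define Q where "Q i \<longleftrightarrow> i \<le> M * n \<and> x ! i \<noteq> z ! i" for i
  have "\<exists>i. Q i" using T_eqI[OF x z] ne Q_def by auto
  moreover have bd: "Q i \<Longrightarrow> i \<le> M * n" for i using Q_def by simp
  ultimately have "Q (Greatest Q)" by (metis GreatestI_nat)
  moreover define i where "i = Greatest Q"
  ultimately have i: "i \<le> M * n" "x ! i < z ! i" using le'[of i] Q_def by auto
  have above: "x ! j = z ! j" if "i < j" "j \<le> M * n" for j
    using that Greatest_le_nat[of Q j "M * n"] bd i_def Q_def by fastforce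
  have nd: "\<not> M dvd i" using T_dvd[OF x] T_dvd[OF z] i by force
  then have in': "i < M * n" using i less_mult_if_not_dvd by simp
  have "z ! (i + 1) < z ! i" using above[of "i + 1"] T_Suc_le[OF x i(1) nd] in' i by simp
  then have d: "i \<in> descents m n z" using in' descents_iff by simp
  obtain v where g: "gap z i v" using gap_exists[OF z d] .
  have "x ! i \<le> v"
  proof (rule ccontr)
    assume "\<not> x ! i \<le> v"
    then have *: "M * v + 1 \<le> M * x ! i" using mult_less_imp by simp
    moreover have "i < M * v + 1" using g unfolding gap_def by simp
    ultimately have "x ! (M * v + 1) \<le> x ! i" using T_nest[OF x i(1)] by simp
    moreover have "M * v + 1 \<le> M * n" using * T_val_le[OF x i(1)] by linarith
    ultimately have "z ! (M * v + 1) \<le> x ! i" using above \<open>i < M * v + 1\<close> by simp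
    then show False using i g unfolding gap_def by simp
  qed
  then have "x \<sqsubseteq>\<^bsub>L\<^esub> z[i := v]" using le_iff[OF x lowered_in_T[OF z d g]] le'
    by (simp add: nth_update[OF z])
  then show ?thesis using that d g by blast
qed

lemma lowered_less:
  assumes z: "z \<in> T" and d: "i \<in> descents m n z" and g: "gap z i v"
  shows "z[i := v] \<sqsubset>\<^bsub>L\<^esub> z"
proof -
  have vz: "v < z ! i" using g unfolding gap_def by simp
  have "i < length z" using d descents_iff T_length[OF z] by simp
  then have "z[i := v] \<noteq> z" using vz by (metis nth_list_update_eq less_irrefl)
  moreover have "z[i := v] \<sqsubseteq>\<^bsub>L\<^esub> z" using le_iff[OF lowered_in_T[OF assms] z] vz
    by (simp add: nth_update[OF z])
  ultimately show ?thesis using less_iff by blast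
qed

lemma covers_iff: "covers L x z \<longleftrightarrow> z \<in> T \<and> (\<exists>i v. i \<in> descents m n z \<and> gap z i v \<and> x = z[i := v])"
proof (intro iffI conjI)
  assume c: "covers L x z"
  then show z: "z \<in> T" unfolding covers_def by simp
  have x: "x \<in> T" "x \<sqsubseteq>\<^bsub>L\<^esub> z" "x \<noteq> z" using c unfolding covers_def less_iff by auto
  then obtain i v where iv: "i \<in> descents m n z" "gap z i v" "x \<sqsubseteq>\<^bsub>L\<^esub> z[i := v]"
    using below_lowered z by metis
  have "x = z[i := v]" 
  proof (rule ccontr)
    assume "x \<noteq> z[i := v]"
    then have "x \<sqsubset>\<^bsub>L\<^esub> z[i := v]" using iv less_iff by simp
    then show False using c lowered_less[OF z iv(1,2)] lowered_in_T[OF z iv(1,2)] unfolding covers_def by auto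
  qed
  then show "\<exists>i v. i \<in> descents m n z \<and> gap z i v \<and> x = z[i := v]" using iv by blast
next
  assume "z \<in> T \<and> (\<exists>i v. i \<in> descents m n z \<and> gap z i v \<and> x = z[i := v])"
  then obtain i v where z: "z \<in> T" and iv: "i \<in> descents m n z" "gap z i v" "x = z[i := v]" by blast
  have x: "x \<in> T" "x \<sqsubset>\<^bsub>L\<^esub> z" using lowered_in_T lowered_less z iv by auto
  have il: "i < length z" "i \<le> M * n" using iv descents_iff T_length[OF z] by auto
  have "False" if w: "w \<in> T" and xw: "x \<sqsubset>\<^bsub>L\<^esub> w" and wz: "w \<sqsubset>\<^bsub>L\<^esub> z" for w
  proof -
    obtain i' v' where iv': "i' \<in> descents m n z" "gap z i' v'" "w \<sqsubseteq>\<^bsub>L\<^esub> z[i' := v']"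
      using below_lowered[OF w z] wz less_iff by auto
    have T': "z[i' := v'] \<in> T" using lowered_in_T z iv' by blast
    have il': "i' < length z" "i' \<le> M * n" using iv' descents_iff T_length[OF z] by auto
    have "w ! i' \<le> v'" using iv' le_iff[OF w T'] il' by (metis nth_list_update_eq)
    moreover have "x ! i' \<le> w ! i'" using xw less_iff le_iff[OF x(1) w] il' by blast
    moreover have "v' < z ! i'" using iv' unfolding gap_def by simp
    \<comment> \<open>\<open>x\<close> differs from \<open>z\<close> only at \<open>i\<close>,
      whereas it is strictly below \<open>z\<close> at \<open>i'\<close>.\<close>
    ultimately have "i' = i" using iv(3) by (metis leD le_trans nth_list_update_neq)
    moreover then have "v' = v" using gap_unique iv iv' by blast
    ultimately have "w \<sqsubseteq>\<^bsub>L\<^esub> x" using iv iv' by simp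
    then show False using T_antisym x w xw less_iff by blast
  qed
  then show "covers L x z" unfolding covers_def using x z by auto
qed

section \<open>Labels and rowmotion\<close>

text \<open>
  The least vector with value at least $k$ at $i$. For admissible $(i,k)$ these are exactly the
  join-irreducibles, and \<open>kappa_vec i k\<close> below is the image of \<open>jirr i k\<close> under $\kappa$.
\<close>

definition jirr :: "nat \<Rightarrow> nat \<Rightarrow> nat list" where
  "jirr i k = map (\<lambda>j. if row j = row i \<and> j \<le> i then k else row j) [0..<M * n + 1]"

definition kappa_vec :: "nat \<Rightarrow> nat \<Rightarrow> nat list" where
  "kappa_vec i k = map (\<lambda>j. if M dvd j then row j else if i \<le> j \<and> j \<le> M * (k - 1) then k - 1 else n) [0..<M * n + 1]"

definition admissible :: "nat \<Rightarrow> nat \<Rightarrow> bool" where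
  "admissible i k \<longleftrightarrow> \<not> M dvd i \<and> row i < k \<and> k \<le> n"

lemma nth_jirr: "j \<le> M * n \<Longrightarrow> jirr i k ! j = (if row j = row i \<and> j \<le> i then k else row j)"
  unfolding jirr_def by (subst nth_map) (auto simp del: upt_Suc)

lemma nth_kappa_vec: "j \<le> M * n \<Longrightarrow> kappa_vec i k ! j =
    (if M dvd j then row j else if i \<le> j \<and> j \<le> M * (k - 1) then k - 1 else n)"
  unfolding kappa_vec_def by (subst nth_map) (auto simp del: upt_Suc)

lemma admissible_le: "admissible i k \<Longrightarrow> i \<le> M * (k - 1) \<and> i \<le> M * k \<and> i < M * n \<and> k > 0"
  unfolding admissible_def using row_le_iff[of i "k - 1"] row_le_iff[of i k] row_le_iff[of i n]
    less_mult_if_not_dvd[of i n] by auto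

lemma dvd_not_less_same_row: "M dvd j \<Longrightarrow> row j = row i \<Longrightarrow> i \<le> j"
  using le_mult_row[of i] by (auto elim!: dvdE)

lemma jirr_in_T:
  assumes a: "admissible i k" shows "jirr i k \<in> T"
  unfolding T_iff
proof (intro conjI allI impI)
  have k: "row i < k" "k \<le> n" "\<not> M dvd i" using a unfolding admissible_def by auto
  have inl: "i \<le> M * n" using admissible_le[OF a] by simp
  show "length (jirr i k) = M * n + 1" by (simp add: jirr_def)
  show "jirr i k ! (M * q) = q" if "q \<le> n" for q
  proof -
    have "\<not> (row (M * q) = row i \<and> M * q \<le> i)"
      using dvd_not_less_same_row[of "M * q" i] k(3) by (metis dvd_triv_left le_antisym)
    then show ?thesis using that nth_jirr[of "M * q" i k] by auto
  qed
  show "j \<le> M * jirr i k ! j" if "j \<le> M * n" for j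
    using that le_mult_row[of j] k row_le_iff[of j k] by (auto simp: nth_jirr)
  show "jirr i k ! j \<le> n" if "j \<le> M * n" for j
    using that k row_le_iff[of j n] by (auto simp: nth_jirr)
  fix p j assume pj: "p < j \<and> j \<le> M * jirr i k ! p \<and> p \<le> M * n"
  then have pn: "p \<le> M * n" by simp
  have "jirr i k ! p \<le> n" using pn k row_le_iff[of p n] by (auto simp: nth_jirr)
  then have "M * jirr i k ! p \<le> M * n" by simp
  then have j: "j \<le> M * n" using pj by linarith
  have cj: "row j \<le> jirr i k ! p" using pj row_le_iff by simp
  show "jirr i k ! j \<le> jirr i k ! p"
  proof (cases "row j = row i \<and> j \<le> i")
    case True
    show ?thesis
    proof (cases "row p = row i")
      case True
      then show ?thesis using \<open>row j = row i \<and> j \<le> i\<close> pj j pn by (simp add: nth_jirr)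
    next
      case False
      then have "jirr i k ! p = row p" using pn by (simp add: nth_jirr)
      then have "row i \<le> row p" using cj True by simp
      moreover have "row p \<le> row j" using pj row_mono by simp
      ultimately show ?thesis using False True by simp
    qed
  next
    case False
    then show ?thesis using cj j by (simp only: nth_jirr if_False)
  qed
qed

text \<open>A position \<open>j\<close> left of \<open>i\<close> in the same row satisfies
  \<open>i \<le> M * b ! j\<close>, so by nesting its entry is at least \<open>b ! i\<close>. That
  is why \<open>jirr i k\<close> carries \<open>k\<close> on the whole part of the row up to
  \<open>i\<close>.\<close>

lemma jirr_le_iff:
  assumes a: "admissible i k" and b: "b \<in> T"
  shows "jirr i k \<sqsubseteq>\<^bsub>L\<^esub> b \<longleftrightarrow> k \<le> b ! i"
proof
  have inl: "i \<le> M * n" using admissible_le[OF a] by simp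
  assume "jirr i k \<sqsubseteq>\<^bsub>L\<^esub> b"
  then show "k \<le> b ! i" using le_iff[OF jirr_in_T[OF a] b] inl by (auto simp: nth_jirr)
next
  have inl: "i \<le> M * n" using admissible_le[OF a] by simp
  assume k: "k \<le> b ! i"
  have "jirr i k ! j \<le> b ! j" if j: "j \<le> M * n" for j
  proof (cases "row j = row i \<and> j \<le> i")
    case True
    have "row i \<le> b ! j" using T_row[OF b j] True by simp
    then have "i \<le> M * b ! j" using row_le_iff by simp
    then have "b ! i \<le> b ! j" using T_nest_le[OF b j] True by simp
    then show ?thesis using True k j by (simp add: nth_jirr)
  next
    case False
    then have "jirr i k ! j = row j" using j by (simp only: nth_jirr if_False)
    then show ?thesis using T_row[OF b j] by simp
  qed
  then show "jirr i k \<sqsubseteq>\<^bsub>L\<^esub> b" using le_iff[OF jirr_in_T[OF a] b] by simp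
qed

lemma descents_jirr:
  assumes a: "admissible i k" shows "descents m n (jirr i k) = {i}"
proof (intro Set.set_eqI iffI)
  have k: "row i < k" "k \<le> n" "\<not> M dvd i" using a unfolding admissible_def by auto
  have inl: "i < M * n" using admissible_le[OF a] by simp
  fix j
  {
    assume d: "j \<in> descents m n (jirr i k)"
    have nd: "\<not> M dvd j" using descent_not_dvd[OF jirr_in_T[OF a] d] .
    have c: "row (j + 1) = row j" using row_Suc_not_mult[OF nd] .
    have j: "j < M * n" "jirr i k ! (j + 1) < jirr i k ! j" using d descents_iff by auto
    then have "j = i \<or> j < i \<or> i < j" "j + 1 \<le> M * n" by auto
    then show "j \<in> {i}" using j c by (auto simp: nth_jirr split: if_splits)
  next
    assume "j \<in> {i}"
    then have "j = i" by simp
    then show "j \<in> descents m n (jirr i k)" using inl k row_Suc_not_mult[OF k(3)]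
      by (simp add: descents_iff nth_jirr)
  }
qed

lemma gap_jirr:
  assumes a: "admissible i k" shows "gap (jirr i k) i (k - 1)"
  unfolding gap_def
proof (intro conjI allI impI)
  have k: "row i < k" "k \<le> n" "\<not> M dvd i" using a unfolding admissible_def by auto
  have il: "i < M * n" "i \<le> M * (k - 1)" "k > 0" using admissible_le[OF a] by auto
  have Ji: "jirr i k ! i = k" using il by (simp add: nth_jirr)
  show "i \<le> M * (k - 1)" by fact
  show "k - 1 < jirr i k ! i" using Ji il by simp
  have "k - 1 < n" using k il by simp
  then have "M * (k - 1) + 1 \<le> M * n" using mult_less_imp by blast
  moreover have "row (M * (k - 1) + 1) = k" using row_Suc_mult[of "M * (k - 1)"] il by simp
  ultimately show "jirr i k ! (M * (k - 1) + 1) = jirr i k ! i" using Ji k by (simp add: nth_jirr)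
  fix j assume j: "i < j \<and> j \<le> M * (k - 1)"
  have "M * (k - 1) \<le> M * n" using k by (intro mult_le_mono2) simp
  then have "j \<le> M * n" using j by linarith
  moreover have "row j \<le> k - 1" using j row_le_iff by simp
  ultimately show "jirr i k ! j < jirr i k ! i" using Ji il j by (simp add: nth_jirr)
qed

lemma covers_jirr_iff:
  assumes a: "admissible i k" shows "covers L x (jirr i k) \<longleftrightarrow> x = (jirr i k)[i := k - 1]"
  unfolding covers_iff using jirr_in_T[OF a] descents_jirr[OF a] gap_jirr[OF a]
  by (auto dest: gap_unique[OF gap_jirr[OF a]])

lemma join_irreducible_jirr: "admissible i k \<Longrightarrow> join_irreducible L (jirr i k)"
  unfolding join_irreducible_def by (simp add: jirr_in_T covers_jirr_iff)

lemma lower_star_jirr: "admissible i k \<Longrightarrow> lower_star L (jirr i k) = (jirr i k)[i := k - 1]"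
  unfolding lower_star_def by (simp add: covers_jirr_iff)

text \<open>If \<open>jirr i (j ! i)\<close>, which lies below \<open>j\<close>, were different from
  \<open>j\<close>, it would lie below the only lower cover of \<open>j\<close>; but that cover is
  \<open>j\<close> lowered at \<open>i\<close>, and its entry there is too small.\<close>

lemma join_irreducible_imp_jirr:
  assumes "join_irreducible L j"
  obtains i k where "admissible i k" "j = jirr i k"
proof -
  have j: "j \<in> T" "\<exists>!x. covers L x j" using assms unfolding join_irreducible_def by auto
  then obtain i v where iv: "i \<in> descents m n j" "gap j i v" using covers_iff by blast
  have inl: "i < M * n" "i < length j" using descent_less[OF iv(1)] T_length[OF j(1)] by auto
  have v: "v < j ! i" "i \<le> M * v" using iv(2) unfolding gap_def by auto
  have a: "admissible i (j ! i)" unfolding admissible_def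
    using descent_not_dvd[OF j(1) iv(1)] v T_upper[OF j(1), of i] inl row_le_iff[of i v] by auto
  have le: "jirr i (j ! i) \<sqsubseteq>\<^bsub>L\<^esub> j" using jirr_le_iff[OF a j(1)] by simp
  have "False" if ne: "jirr i (j ! i) \<noteq> j"
  proof -
    obtain i' v' where i'v': "i' \<in> descents m n j" "gap j i' v'" "jirr i (j ! i) \<sqsubseteq>\<^bsub>L\<^esub> j[i' := v']"
      using below_lowered[OF jirr_in_T[OF a] j(1) le ne] .
    have "covers L (j[i' := v']) j" "covers L (j[i := v]) j" using covers_iff iv i'v' j(1) by auto
    then have "j[i' := v'] = j[i := v]" using j(2) by blast
    then have "jirr i (j ! i) \<sqsubseteq>\<^bsub>L\<^esub> j[i := v]" using i'v' by simp
    then have "j ! i \<le> j[i := v] ! i" using jirr_le_iff[OF a lowered_in_T[OF j(1) iv]] by simp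
    then show False using v inl by simp
  qed
  then show ?thesis using that a by metis
qed

lemma kappa_vec_in_T:
  assumes a: "admissible i k" shows "kappa_vec i k \<in> T"
  unfolding T_iff
proof (intro conjI allI impI)
  have k: "row i < k" "k \<le> n" "\<not> M dvd i" using a unfolding admissible_def by auto
  show "length (kappa_vec i k) = M * n + 1" by (simp add: kappa_vec_def)
  show "kappa_vec i k ! (M * q) = q" if "q \<le> n" for q
    using that by (simp add: nth_kappa_vec)
  show "j \<le> M * kappa_vec i k ! j" if "j \<le> M * n" for j
    using that le_mult_row[of j] by (simp add: nth_kappa_vec)
  show Kn: "kappa_vec i k ! j \<le> n" if "j \<le> M * n" for j
    using that k row_le_iff[of j n] by (auto simp: nth_kappa_vec)
  fix p j assume pj: "p < j \<and> j \<le> M * kappa_vec i k ! p \<and> p \<le> M * n"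
  have "M * kappa_vec i k ! p \<le> M * n" using Kn pj by simp
  then have j: "j \<le> M * n" using pj by linarith
  have nd: "\<not> M dvd p" using pj by (auto simp: nth_kappa_vec elim!: dvdE)
  have cj: "row j \<le> kappa_vec i k ! p" using pj row_le_iff by simp
  show "kappa_vec i k ! j \<le> kappa_vec i k ! p"
  proof (cases "i \<le> p \<and> p \<le> M * (k - 1)")
    case True
    then have e: "kappa_vec i k ! p = k - 1" using pj nd by (simp add: nth_kappa_vec)
    then have "i \<le> j \<and> j \<le> M * (k - 1)" using True pj by (metis le_trans less_imp_le)
    then show ?thesis using e cj j by (simp add: nth_kappa_vec)
  next
    case False
    then have "kappa_vec i k ! p = n" using pj nd by (simp only: nth_kappa_vec if_False)
    then show ?thesis using Kn[OF j] by simp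
  qed
qed

lemma le_kappa_vec_iff:
  assumes a: "admissible i k" and b: "b \<in> T"
  shows "b \<sqsubseteq>\<^bsub>L\<^esub> kappa_vec i k \<longleftrightarrow> (\<forall>j. i \<le> j \<and> j \<le> M * (k - 1) \<longrightarrow> b ! j \<le> k - 1)"
proof (intro iffI allI impI)
  have "k - 1 \<le> n" using a unfolding admissible_def by linarith
  then have kn: "M * (k - 1) \<le> M * n" by simp
  fix j assume le: "b \<sqsubseteq>\<^bsub>L\<^esub> kappa_vec i k" and j: "i \<le> j \<and> j \<le> M * (k - 1)"
  have "j \<le> M * n" using j kn by linarith
  moreover then have "b ! j \<le> kappa_vec i k ! j" using le_iff[OF b kappa_vec_in_T[OF a]] le by simp
  moreover have "row j \<le> k - 1" using j row_le_iff by simp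
  ultimately show "b ! j \<le> k - 1" using j by (simp add: nth_kappa_vec split: if_splits)
next
  assume H: "\<forall>j. i \<le> j \<and> j \<le> M * (k - 1) \<longrightarrow> b ! j \<le> k - 1"
  show "b \<sqsubseteq>\<^bsub>L\<^esub> kappa_vec i k" unfolding le_iff[OF b kappa_vec_in_T[OF a]]
    using H T_dvd[OF b] T_upper[OF b] by (simp add: nth_kappa_vec)
qed

section \<open>Meets and the map kappa\<close>

definition vmin :: "nat list \<Rightarrow> nat list \<Rightarrow> nat list" where
  "vmin x y = map2 min x y"

lemma nth_vmin: "x \<in> T \<Longrightarrow> y \<in> T \<Longrightarrow> i \<le> M * n \<Longrightarrow> vmin x y ! i = min (x ! i) (y ! i)"
  by (simp add: vmin_def T_length)

lemma vmin_in_T: assumes x: "x \<in> T" and y: "y \<in> T" shows "vmin x y \<in> T"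
  unfolding T_iff
proof (intro conjI allI impI)
  show "length (vmin x y) = M * n + 1" by (simp add: vmin_def T_length assms)
  show "vmin x y ! (M * q) = q" if "q \<le> n" for q
    using that by (simp add: nth_vmin x y T_mult)
  show "j \<le> M * vmin x y ! j" if "j \<le> M * n" for j
    using that T_lower[OF x] T_lower[OF y] by (simp add: nth_vmin x y min_def)
  show "vmin x y ! j \<le> n" if "j \<le> M * n" for j
    using that T_upper[OF x] by (simp add: nth_vmin x y min.coboundedI1)
  fix p j assume pj: "p < j \<and> j \<le> M * vmin x y ! p \<and> p \<le> M * n"
  then have p: "p < j" "p \<le> M * n" by auto
  have e: "vmin x y ! p = min (x ! p) (y ! p)" using p nth_vmin x y by simp
  have "vmin x y ! p \<le> x ! p" "vmin x y ! p \<le> y ! p" using e by auto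
  then have "M * vmin x y ! p \<le> M * x ! p" "M * vmin x y ! p \<le> M * y ! p" by (simp_all add: mult_le_mono2)
  then have xy: "j \<le> M * x ! p" "j \<le> M * y ! p" using pj by linarith+
  have j: "j \<le> M * n" using xy T_val_le[OF x p(2)] by linarith
  have "x ! j \<le> x ! p" "y ! j \<le> y ! p" using T_nest x y p xy by auto
  then show "vmin x y ! j \<le> vmin x y ! p" using e nth_vmin[OF x y j] by (auto simp: min_def)
qed

lemma meet_eq:
  assumes x: "x \<in> T" and y: "y \<in> T" shows "x \<sqinter>\<^bsub>L\<^esub> y = vmin x y"
proof -
  have g: "greatest L (vmin x y) (Lower L {x, y})"
    unfolding greatest_def Lower_def using vmin_in_T[OF x y] x y
    by (auto simp: le_iff nth_vmin)
  have "\<Sqinter>\<^bsub>L\<^esub>{x, y} = vmin x y" unfolding inf_def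
  proof (rule some_equality, rule g)
    fix w assume w: "greatest L w (Lower L {x, y})"
    have "vmin x y \<in> Lower L {x, y}" "w \<in> Lower L {x, y}" using g w unfolding greatest_def by auto
    then have "vmin x y \<sqsubseteq>\<^bsub>L\<^esub> w" "w \<sqsubseteq>\<^bsub>L\<^esub> vmin x y" "w \<in> T" 
      using g w unfolding greatest_def by (auto simp: Lower_def)
    then show "w = vmin x y" using T_antisym vmin_in_T[OF x y] by blast
  qed
  then show ?thesis unfolding meet_def .
qed

text \<open>The meet with \<open>jirr i k\<close> must be \<open>k - 1\<close> at \<open>i\<close>,
  which forces \<open>z ! i = k - 1\<close>; nesting then carries the bound \<open>k - 1\<close> up
  to \<open>M * (k - 1)\<close>. These bounds describe exactly the vectors below
  \<open>kappa_vec i k\<close>.\<close>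

lemma kappa_jirr:
  assumes a: "admissible i k" shows "kappa L (jirr i k) = kappa_vec i k"
proof -
  have k: "row i < k" "k \<le> n" "\<not> M dvd i" using a unfolding admissible_def by auto
  have il: "i < M * n" "i \<le> M * (k - 1)" "k > 0" using admissible_le[OF a] by auto
  let ?S = "{z \<in> carrier L. z \<sqinter>\<^bsub>L\<^esub> jirr i k = lower_star L (jirr i k)}"
  note KT = kappa_vec_in_T[OF a] note JT = jirr_in_T[OF a]
  have lT: "lower_star L (jirr i k) \<in> T" unfolding lower_star_jirr[OF a]
    using lowered_in_T[OF JT _ gap_jirr[OF a]] descents_jirr[OF a] by simp
  have "vmin (kappa_vec i k) (jirr i k) = lower_star L (jirr i k)"
  proof (rule T_eqI[OF vmin_in_T[OF KT JT] lT])
    fix j assume j: "j \<le> M * n"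
    have e: "vmin (kappa_vec i k) (jirr i k) ! j = min (kappa_vec i k ! j) (jirr i k ! j)" using nth_vmin[OF KT JT j] .
    consider "j = i" | "row j = row i" "j < i" | "\<not> (row j = row i \<and> j \<le> i)" by linarith
    then show "vmin (kappa_vec i k) (jirr i k) ! j = lower_star L (jirr i k) ! j"
      unfolding lower_star_jirr[OF a] e nth_update[OF JT j]
    proof cases
      case 1 then show "min (kappa_vec i k ! j) (jirr i k ! j) = (if j = i then k - 1 else jirr i k ! j)"
        using j k il by (simp add: nth_jirr nth_kappa_vec)
    next
      case 2
      then have "\<not> M dvd j" using dvd_not_less_same_row[of j i] by linarith
      then show "min (kappa_vec i k ! j) (jirr i k ! j) = (if j = i then k - 1 else jirr i k ! j)"
        using 2 j k by (simp add: nth_jirr nth_kappa_vec)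
    next
      case 3
      then have "jirr i k ! j = row j" using j by (simp only: nth_jirr if_False)
      moreover have "j \<noteq> i" using 3 by auto
      moreover have "row j \<le> kappa_vec i k ! j" using T_row[OF KT j] .
      ultimately show "min (kappa_vec i k ! j) (jirr i k ! j) = (if j = i then k - 1 else jirr i k ! j)"
        by simp
    qed
  qed
  then have inS: "kappa_vec i k \<in> ?S" using KT meet_eq[OF KT JT] by simp
  have up: "z \<sqsubseteq>\<^bsub>L\<^esub> kappa_vec i k" if "z \<in> ?S" for z
  proof -
    have z: "z \<in> T" "vmin z (jirr i k) = (jirr i k)[i := k - 1]"
      using that meet_eq JT lower_star_jirr[OF a] by auto
    have "min (z ! i) (jirr i k ! i) = (jirr i k)[i := k - 1] ! i"
      using z nth_vmin[OF z(1) JT, of i] il by simp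
    then have "min (z ! i) k = k - 1" using il nth_update[OF JT, of i] by (simp add: nth_jirr)
    then have zi: "z ! i = k - 1" using il by (simp add: min_def split: if_splits)
    then show ?thesis unfolding le_kappa_vec_iff[OF a z(1)] using T_nest_le[OF z(1), of i] il by auto
  qed
  have g: "greatest L (kappa_vec i k) ?S" unfolding greatest_def using inS up by auto
  show ?thesis unfolding kappa_def
  proof (rule the_equality, rule g)
    fix w assume w: "greatest L w ?S"
    then have "w \<in> ?S" "kappa_vec i k \<sqsubseteq>\<^bsub>L\<^esub> w" using inS unfolding greatest_def by auto
    then show "w = kappa_vec i k" using up T_antisym KT by auto
  qed
qed

text \<open>For uniqueness, a label \<open>jirr i' k\<close> needs \<open>z ! i' \<ge> k\<close>
  while the lower element has at most \<open>k - 1\<close> at \<open>i'\<close>; hence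
  \<open>i' = i\<close> and \<open>v \<le> k - 1\<close>. If \<open>v < k - 1\<close>, the bound
  \<open>k - 1\<close> would also apply to position \<open>M * v + 1\<close>, whose entry is
  \<open>z ! i\<close>.\<close>

lemma cover_label_eq:
  assumes z: "z \<in> T" and d: "i \<in> descents m n z" and g: "gap z i v"
  shows "cover_label L (z[i := v]) z = jirr i (v + 1)" and "admissible i (v + 1)"
proof -
  have v: "i \<le> M * v" "v < z ! i" "z ! (M * v + 1) = z ! i" using g unfolding gap_def by auto
  have il: "i < M * n" using descent_less[OF d] .
  have zn: "z ! i \<le> n" using T_upper[OF z] il by simp
  show a: "admissible i (v + 1)" unfolding admissible_def
    using v zn descent_not_dvd[OF z d] row_le_iff[of i v] by auto
  note xT = lowered_in_T[OF assms]
  have xi: "z[i := v] ! i = v" using nth_update[OF z, of i] il by simp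
  show "cover_label L (z[i := v]) z = jirr i (v + 1)" unfolding cover_label_def
  proof (rule the_equality)
    have "z[i := v] \<sqsubseteq>\<^bsub>L\<^esub> kappa_vec i (v + 1)" unfolding le_kappa_vec_iff[OF a xT]
      using T_nest_le[OF xT, of i] xi il by auto
    then show "join_irreducible L (jirr i (v + 1)) \<and> jirr i (v + 1) \<sqsubseteq>\<^bsub>L\<^esub> z \<and> z[i := v] \<sqsubseteq>\<^bsub>L\<^esub> kappa L (jirr i (v + 1))"
      using join_irreducible_jirr[OF a] jirr_le_iff[OF a z] v kappa_jirr[OF a] by simp
  next
    fix j assume j: "join_irreducible L j \<and> j \<sqsubseteq>\<^bsub>L\<^esub> z \<and> z[i := v] \<sqsubseteq>\<^bsub>L\<^esub> kappa L j"
    then obtain i' k where a': "admissible i' k" "j = jirr i' k" using join_irreducible_imp_jirr by metis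
    have zk: "k \<le> z ! i'" using j a' jirr_le_iff[OF a'(1) z] by simp
    have il': "i' \<le> M * (k - 1)" "i' < M * n" "k > 0" using admissible_le[OF a'(1)] by auto
    have xk: "z[i := v] ! p \<le> k - 1" if "i' \<le> p" "p \<le> M * (k - 1)" for p
      using j that le_kappa_vec_iff[OF a'(1) xT] kappa_jirr[OF a'(1)] a' by simp
    have "z[i := v] ! i' \<le> k - 1" using xk il' by simp
    then have ii: "i' = i" using nth_update[OF z, of i' i v] zk il' by (cases "i' = i") auto
    then have vk: "v \<le> k - 1" using xk[of i] xi il' by simp
    moreover have "\<not> v < k - 1"
    proof
      assume "v < k - 1"
      then have le: "M * v + 1 \<le> M * (k - 1)" using mult_less_imp by blast
      moreover have "i < M * v + 1" using v by simp
      moreover have "k - 1 \<le> n" using a' unfolding admissible_def by linarith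
      then have "M * (k - 1) \<le> M * n" by simp
      ultimately have "z ! (M * v + 1) \<le> k - 1" using xk[of "M * v + 1"] ii nth_update[OF z, of "M * v + 1" i v] by simp
      then show False using v zk ii il' by simp
    qed
    ultimately have "k = v + 1" using il' by simp
    then show "j = jirr i (v + 1)" using a' ii by simp
  qed
qed

lemma jirr_inject:
  assumes "admissible i k" "admissible i' k'" "jirr i k = jirr i' k'"
  shows "i = i' \<and> k = k'"
proof -
  have "i = i'" using assms descents_jirr by (metis singleton_inject)
  have "jirr i k ! i = k" using admissible_le[OF assms(1)] by (simp add: nth_jirr)
  moreover have "jirr i' k' ! i' = k'" using admissible_le[OF assms(2)] by (simp add: nth_jirr)
  ultimately show ?thesis using assms \<open>i = i'\<close> by metis
qed

lemma down_labels_eq: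
  assumes z: "z \<in> T"
  shows "down_labels L z = {jirr i (v + 1) | i v. i \<in> descents m n z \<and> gap z i v}"
  unfolding down_labels_def covers_iff using z cover_label_eq by (auto; metis)

section \<open>Upper covers and their labels\<close>

definition first_occ :: "nat list \<Rightarrow> nat \<Rightarrow> bool" where
  "first_occ b i \<longleftrightarrow> (\<forall>j<i. b ! j \<noteq> b ! i)"

text \<open>Positions that can be raised; dual to descents by the lemmas below.\<close>

definition ascents :: "nat list \<Rightarrow> nat set" where
  "ascents x = {i. i \<le> M * n \<and> \<not> M dvd i \<and> first_occ x i \<and> x ! i < n}"

lemma up_cover_ascent:
  assumes z: "z \<in> T" and d: "i \<in> descents m n z" and g: "gap z i v"
  shows "i \<in> ascents (z[i := v]) \<and> z[i := v] ! i = v"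
proof -
  have v: "i \<le> M * v" "v < z ! i" "z ! (M * v + 1) = z ! i" using g unfolding gap_def by auto
  have il: "i < M * n" using descent_less[OF d] .
  have zn: "z ! i \<le> n" using T_upper[OF z] il by simp
  have xi: "z[i := v] ! i = v" using nth_update[OF z, of i] il by simp
  have "z ! j \<noteq> v" if "j < i" for j
  proof
    assume "z ! j = v"
    then have "z ! i \<le> v" using T_nest[OF z, of j i] that v il by simp
    then show False using v by simp
  qed
  then have "first_occ (z[i := v]) i" unfolding first_occ_def xi by simp
  then show ?thesis unfolding ascents_def using il descent_not_dvd[OF z d] xi v zn by simp
qed

lemma ascent_up_cover:
  assumes x: "x \<in> T" and i: "i \<in> ascents x"
  obtains y where "y \<in> T" "i \<in> descents m n y" "gap y i (x ! i)" "x = y[i := x ! i]"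
proof -
  define v where "v = x ! i"
  have i': "i \<le> M * n" "\<not> M dvd i" "first_occ x i" "v < n" using i unfolding ascents_def v_def by auto
  have iv: "i \<le> M * v" "i < M * v" using T_lower[OF x i'(1)] T_less[OF x i'(1,2)] v_def by auto
  \<comment> \<open>The value is forced: in the upper cover the entry at \<open>i\<close> must recur
    at \<open>M * v + 1\<close>, and that position is not changed.\<close>
  define k where "k = x ! (M * v + 1)"
  have vn: "M * v + 1 \<le> M * n" using i'(4) mult_less_imp by blast
  have "M * v + 1 \<le> M * k" using T_lower[OF x vn] k_def by simp
  then have vk: "v < k" using mult_le_imp by blast
  then have vk': "M * v \<le> M * k" by simp
  have kn: "k \<le> n" using T_upper[OF x vn] k_def by simp
  define y where "y = x[i := k]"
  have yT: "y \<in> T" unfolding y_def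
  proof (rule update_in_T[OF x i'(1,2) _ kn])
    show "i \<le> M * k" using iv vk' by linarith
  next
    fix j assume j: "i < j" "j \<le> M * k"
    show "x ! j \<le> k"
    proof (cases "j \<le> M * v")
      case True
      then show ?thesis using T_nest[OF x i'(1) j(1)] vk v_def by simp
    next
      case False
      then show ?thesis using T_nest_le[OF x vn, of j] j k_def by simp
    qed
  next
    fix j assume j: "j < i" "i \<le> M * x ! j"
    \<comment> \<open>Since \<open>i\<close> is the first occurrence of \<open>v\<close>, the entry
      at \<open>j\<close> exceeds \<open>v\<close> and therefore reaches \<open>M * v + 1\<close>,
      whose entry is \<open>k\<close>.\<close>
    have "v \<le> x ! j" using T_nest[OF x _ j] j i'(1) v_def by simp
    moreover have "x ! j \<noteq> v" using i'(3) j v_def unfolding first_occ_def by simp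
    ultimately have "M * v + 1 \<le> M * x ! j" using mult_less_imp by simp
    then show "k \<le> x ! j" using T_nest_le[OF x, of j "M * v + 1"] j iv i'(1) k_def by simp
  qed
  have ny: "j \<le> M * n \<Longrightarrow> y ! j = (if j = i then k else x ! j)" for j
    unfolding y_def using nth_update[OF x] by simp
  have inl: "i < M * n" using iv vn by linarith
  have d: "i \<in> descents m n y" unfolding descents_iff
    using inl ny[of i] ny[of "i + 1"] T_Suc_le[OF x i'(1,2)] vk v_def by simp
  have g: "gap y i v" unfolding gap_def
  proof (intro conjI allI impI)
    show "i \<le> M * v" by fact
    show "v < y ! i" using ny[OF i'(1)] vk by simp
    show "y ! (M * v + 1) = y ! i" using ny[OF i'(1)] ny[OF vn] iv k_def by simp
    fix j assume j: "i < j \<and> j \<le> M * v"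
    then have "j \<le> M * n" using vn by linarith
    then show "y ! j < y ! i" using ny[of j] ny[OF i'(1)] j T_nest[OF x i'(1), of j] vk v_def by simp
  qed
  have "x = y[i := v]" unfolding y_def v_def by simp
  then show ?thesis using that[of y] yT d g v_def by simp
qed

lemma up_labels_eq:
  assumes x: "x \<in> T"
  shows "up_labels L x = {jirr i (x ! i + 1) | i. i \<in> ascents x}"
proof (intro Set.set_eqI iffI)
  fix j assume "j \<in> up_labels L x"
  then obtain y where c: "covers L x y" "j = cover_label L x y" unfolding up_labels_def by blast
  then obtain i v where y: "y \<in> T" "i \<in> descents m n y" "gap y i v" "x = y[i := v]"
    using covers_iff by blast
  then have "j = jirr i (v + 1)" using c cover_label_eq by simp
  then show "j \<in> {jirr i (x ! i + 1) | i. i \<in> ascents x}" using up_cover_ascent[OF y(1-3)] y(4) by (metis (mono_tags, lifting) mem_Collect_eq)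
next
  fix j assume "j \<in> {jirr i (x ! i + 1) | i. i \<in> ascents x}"
  then obtain i where i: "i \<in> ascents x" "j = jirr i (x ! i + 1)" by blast
  obtain y where y: "y \<in> T" "i \<in> descents m n y" "gap y i (x ! i)" "x = y[i := x ! i]"
    using ascent_up_cover[OF x i(1)] .
  have "covers L x y" using covers_iff y by blast
  moreover have "j = cover_label L x y" using cover_label_eq[OF y(1-3)] y(4) i by simp
  ultimately show "j \<in> up_labels L x" unfolding up_labels_def by blast
qed

lemma ascent_admissible:
  assumes "x \<in> T" "i \<in> ascents x" shows "admissible i (x ! i + 1)"
  using assms T_row[of x i] unfolding ascents_def admissible_def by auto

lemma labels_eq_iff:
  assumes y: "y \<in> T" and z: "z \<in> T"
  shows "up_labels L y = down_labels L z \<longleftrightarrow>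
    ascents y = descents m n z \<and> (\<forall>i \<in> descents m n z. gap z i (y ! i))"
proof
  assume e: "up_labels L y = down_labels L z"
  have 1: "i \<in> descents m n z \<and> gap z i (y ! i)" if "i \<in> ascents y" for i
  proof -
    have "jirr i (y ! i + 1) \<in> down_labels L z" using that e up_labels_eq[OF y] by blast
    then obtain i' v where "i' \<in> descents m n z" "gap z i' v" "jirr i (y ! i + 1) = jirr i' (v + 1)"
      using down_labels_eq[OF z] by blast
    then show ?thesis using jirr_inject[OF ascent_admissible[OF y that] cover_label_eq(2)[OF z]] by simp metis
  qed
  have 2: "i \<in> ascents y" if d: "i \<in> descents m n z" for i
  proof -
    obtain v where g: "gap z i v" using gap_exists[OF z d] .
    then have "jirr i (v + 1) \<in> up_labels L y" using d e down_labels_eq[OF z] by blast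
    then obtain i' where "i' \<in> ascents y" "jirr i' (y ! i' + 1) = jirr i (v + 1)" using up_labels_eq[OF y] by auto
    then show ?thesis using jirr_inject[OF ascent_admissible[OF y] cover_label_eq(2)[OF z d g]] by blast
  qed
  show "ascents y = descents m n z \<and> (\<forall>i \<in> descents m n z. gap z i (y ! i))" using 1 2 by blast
next
  assume H: "ascents y = descents m n z \<and> (\<forall>i \<in> descents m n z. gap z i (y ! i))"
  then show "up_labels L y = down_labels L z"
    unfolding up_labels_eq[OF y] down_labels_eq[OF z] using gap_unique by (auto; metis)
qed

section \<open>Existence and uniqueness of rowmotion\<close>

lemma ascent_below:
  assumes y: "y \<in> T" and j: "j \<le> M * n" "\<not> M dvd j" "y ! j < n"
  obtains i where "i \<in> ascents y" "i \<le> j" "y ! i = y ! j"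
proof -
  define i where "i = (LEAST i. y ! i = y ! j)"
  have i: "y ! i = y ! j" "i \<le> j" unfolding i_def by (auto intro: LeastI Least_le)
  have "first_occ y i" unfolding first_occ_def i(1) unfolding i_def using not_less_Least by blast
  \<comment> \<open>A multiple of \<open>M\<close> carrying the value \<open>y ! j\<close> equals
    \<open>M * y ! j\<close>, which is not left of \<open>j\<close>; and \<open>j\<close> itself is
    not a multiple.\<close>
  moreover have "\<not> M dvd i"
  proof
    assume d: "M dvd i"
    have "y ! i = row i" using T_dvd[OF y _ d] i j by simp
    moreover have "i = M * row i" using d by auto
    ultimately have "j \<le> i" using T_lower[OF y j(1)] i by simp
    then show False using d i j by simp
  qed
  ultimately show ?thesis using that[of i] i j unfolding ascents_def by auto
qed

text \<open>Every ascent \<open>i\<close> acts as a bar of height \<open>v i\<close> over the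
  positions from \<open>i\<close> to \<open>M * v i\<close>; off the multiples of \<open>M\<close>,
  an entry is the height of the lowest bar over it, or \<open>n\<close> if there is none. So ascents
  and their values determine the vector, and the same formula defines it in the existence
  proof.\<close>

lemma rowmotion_nth:
  assumes y: "y \<in> T" and a: "ascents y = D" and g: "\<And>i. i \<in> D \<Longrightarrow> y ! i = v i"
    and j: "j \<le> M * n" "\<not> M dvd j"
  shows "y ! j = Min (insert n {v i | i. i \<in> D \<and> i \<le> j \<and> j \<le> M * v i})"
proof (rule sym, rule Min_eqI)
  have "D \<subseteq> {..M * n}" using a unfolding ascents_def by auto
  then have "finite D" using finite_subset by blast
  then show "finite (insert n {v i | i. i \<in> D \<and> i \<le> j \<and> j \<le> M * v i})" by simp
  show "y ! j \<in> insert n {v i |i. i \<in> D \<and> i \<le> j \<and> j \<le> M * v i}"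
  proof (cases "y ! j = n")
    case False
    then have "y ! j < n" using T_upper[OF y j(1)] by simp
    then obtain i where "i \<in> ascents y" "i \<le> j" "y ! i = y ! j" using ascent_below[OF y j] by blast
    then have "i \<in> D" "i \<le> j" "v i = y ! j" using a g by auto
    moreover have "j \<le> M * y ! j" using T_lower[OF y j(1)] .
    ultimately show ?thesis by (intro insertI2 CollectI exI[of _ i]) simp
  qed simp
  fix w assume "w \<in> insert n {v i |i. i \<in> D \<and> i \<le> j \<and> j \<le> M * v i}"
  then consider "w = n" | i where "i \<in> D" "i \<le> j" "j \<le> M * v i" "w = v i" by blast
  then show "y ! j \<le> w"
  proof cases
    case 1 then show ?thesis using T_upper[OF y j(1)] by simp
  next
    case 2
    then show ?thesis using T_nest_le[OF y, of i j] j g by simp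
  qed
qed

lemma rowmotion_exists:
  assumes z: "z \<in> T"
  obtains y where "y \<in> T" "ascents y = descents m n z" "\<And>i. i \<in> descents m n z \<Longrightarrow> gap z i (y ! i)"
proof -
  define v where "v i = (SOME v. gap z i v)" for i
  let ?D = "descents m n z"
  have g: "gap z i (v i)" if "i \<in> ?D" for i
    unfolding v_def using gap_exists[OF z that] by (metis someI)
  have fin: "finite ?D" unfolding descents_def by simp
  define f where "f j = (if M dvd j then row j else Min (insert n {v i | i. i \<in> ?D \<and> i \<le> j \<and> j \<le> M * v i}))" for j
  have f_le_n: "f j \<le> n" if "j \<le> M * n" for j
    using that row_le_iff[of j n] fin unfolding f_def by simp
  have f_le: "f j \<le> v i" if "i \<in> ?D" "i \<le> j" "j \<le> M * v i" for i j
  proof (cases "M dvd j")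
    case True
    then show ?thesis using row_le_iff[of j "v i"] that unfolding f_def by simp
  next
    case False
    then show ?thesis using that fin unfolding f_def by (auto intro!: Min_le)
  qed
  have f_cases: "f j = n \<or> (\<exists>i \<in> ?D. i \<le> j \<and> j \<le> M * v i \<and> f j = v i)" if "\<not> M dvd j" for j
  proof -
    have "Min (insert n {v i | i. i \<in> ?D \<and> i \<le> j \<and> j \<le> M * v i}) \<in> insert n {v i | i. i \<in> ?D \<and> i \<le> j \<and> j \<le> M * v i}"
      using fin by (intro Min_in) auto
    then show ?thesis using that unfolding f_def by auto
  qed
  define y where "y = map f [0..<M * n + 1]"
  have ny: "y ! j = f j" if "j \<le> M * n" for j
    unfolding y_def using that by (subst nth_map) (auto simp del: upt_Suc)
  have ly: "length y = M * n + 1" unfolding y_def by simp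
  have yT: "y \<in> T" unfolding T_iff
  proof (intro conjI allI impI)
    show "length y = M * n + 1" by fact
    show "y ! (M * q) = q" if "q \<le> n" for q using that ny[of "M * q"] unfolding f_def by simp
    show "y ! j \<le> n" if "j \<le> M * n" for j using ny f_le_n that by simp
    show "j \<le> M * y ! j" if "j \<le> M * n" for j
    proof (cases "M dvd j")
      case True
      then show ?thesis using ny[OF that] le_mult_row unfolding f_def by simp
    next
      case False
      then show ?thesis using f_cases[OF False] ny that by auto
    qed
    fix p j assume pj: "p < j \<and> j \<le> M * y ! p \<and> p \<le> M * n"
    have nd: "\<not> M dvd p" using pj ny[of p] unfolding f_def by (auto elim!: dvdE)
    have "M * y ! p \<le> M * n" using ny f_le_n pj by simp
    then have j: "j \<le> M * n" using pj by linarith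
    consider "f p = n" | i where "i \<in> ?D" "i \<le> p" "p \<le> M * v i" "f p = v i" using f_cases[OF nd] by blast
    then show "y ! j \<le> y ! p"
    proof cases
      case 1 then show ?thesis using ny[of p] pj ny[OF j] f_le_n[OF j] by simp
    next
      case 2
      then show ?thesis using f_le[of i j] ny[of p] pj ny[OF j] by simp
    qed
  qed
  \<comment> \<open>A bar that starts under another one is strictly lower: position
    \<open>M * v i' + 1\<close> carries \<open>z ! i'\<close>, which exceeds \<open>z ! i\<close>,
    so it is beyond the reach \<open>M * z ! i\<close>, whereas \<open>M * v i + 1\<close> is within
    it. Hence each bar is the lowest one over its starting point, and no earlier position has its
    height.\<close>
  have laminar: "v i < v i'" if "i \<in> ?D" "i' \<in> ?D" "i' < i" "i \<le> M * v i'" for i i'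
  proof -
    have il: "i \<le> M * n" "i' \<le> M * n" using that descent_less by force+
    have "z ! i < z ! i'" using g[OF that(2)] that unfolding gap_def by simp
    moreover have "M * v i' + 1 \<le> M * z ! i'" using g[OF that(2)] mult_less_imp unfolding gap_def by simp
    moreover have "z ! i < z ! (M * v i' + 1)" using g[OF that(2)] calculation unfolding gap_def by simp
    ultimately have "\<not> M * v i' + 1 \<le> M * z ! i" using T_nest[OF z il(1), of "M * v i' + 1"] that by auto
    moreover have "M * v i + 1 \<le> M * z ! i" using g[OF that(1)] mult_less_imp unfolding gap_def by simp
    ultimately have "M * v i < M * v i'" by linarith
    then show ?thesis by simp
  qed
  have fD: "f i = v i \<and> first_occ y i \<and> v i < n \<and> i \<le> M * n \<and> \<not> M dvd i" if i: "i \<in> ?D" for i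
  proof -
    have nd: "\<not> M dvd i" using descent_not_dvd[OF z i] .
    have il: "i < M * n" using descent_less[OF i] .
    have vi: "v i < z ! i" "i \<le> M * v i" using g[OF i] unfolding gap_def by auto
    have vn: "v i < n" using vi T_upper[OF z, of i] il by simp
    have le: "f i \<le> v i" using f_le i vi by simp
    have fi: "f i = v i"
    proof (rule ccontr)
      assume ne: "f i \<noteq> v i"
      then obtain i' where i': "i' \<in> ?D" "i' \<le> i" "i \<le> M * v i'" "f i = v i'"
        using f_cases[OF nd] vn le by auto
      then have "i' < i" using ne by (cases "i' = i") auto
      then show False using laminar[OF i i'(1)] i' le by simp
    qed
    have "y ! j \<noteq> y ! i" if j: "j < i" for j
    proof
      assume "y ! j = y ! i"
      then have fj: "f j = v i" using ny[of j] ny[of i] il j fi by simp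
      show False
      proof (cases "M dvd j")
        case True
        then have "j = M * v i" using fj unfolding f_def by auto
        then show False using j vi by simp
      next
        case False
        then obtain i' where i': "i' \<in> ?D" "i' \<le> j" "j \<le> M * v i'" "v i = v i'"
          using f_cases[OF False] vn fj by auto
        then show False using laminar[OF i i'(1)] j vi by simp
      qed
    qed
    then show ?thesis using fi vn il nd unfolding first_occ_def by simp
  qed
  have as: "ascents y = ?D"
  proof (intro Set.set_eqI iffI)
    fix i assume "i \<in> ascents y"
    then have i: "i \<le> M * n" "\<not> M dvd i" "first_occ y i" "y ! i < n" unfolding ascents_def by auto
    then obtain i' where i': "i' \<in> ?D" "i' \<le> i" "f i = v i'" using f_cases[OF i(2)] ny by fastforce
    then have "y ! i' = y ! i" using fD[OF i'(1)] ny i by simp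
    then have "i' = i" using i(3) i'(2) unfolding first_occ_def by (metis le_neq_implies_less)
    then show "i \<in> ?D" using i' by simp
  next
    fix i assume "i \<in> ?D"
    then show "i \<in> ascents y" using fD[of i] ny[of i] unfolding ascents_def by simp
  qed
  show ?thesis using that[OF yT as] g fD ny by simp
qed

lemma rowmotion_spec:
  assumes z: "z \<in> T"
  shows "rowmotion L z \<in> T" and "ascents (rowmotion L z) = descents m n z"
    and "\<And>i. i \<in> descents m n z \<Longrightarrow> gap z i (rowmotion L z ! i)"
proof -
  obtain y where y: "y \<in> T" "ascents y = descents m n z" "\<And>i. i \<in> descents m n z \<Longrightarrow> gap z i (y ! i)"
    using rowmotion_exists[OF z] by metis
  have "rowmotion L z = y" unfolding rowmotion_def
  proof (rule the_equality)
    show "y \<in> carrier L \<and> up_labels L y = down_labels L z" using y labels_eq_iff[OF y(1) z] by simp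
  next
    fix w assume "w \<in> carrier L \<and> up_labels L w = down_labels L z"
    then have w: "w \<in> T" "ascents w = descents m n z" "\<And>i. i \<in> descents m n z \<Longrightarrow> gap z i (w ! i)"
      using labels_eq_iff[of w z] z by auto
    show "w = y"
    proof (rule T_eqI[OF w(1) y(1)])
      fix j assume j: "j \<le> M * n"
      show "w ! j = y ! j"
      proof (cases "M dvd j")
        case True
        then show ?thesis using T_dvd w y j by simp
      next
        case False
        have "w ! i = y ! i" if "i \<in> descents m n z" for i using w(3) y(3) that gap_unique by blast
        then show ?thesis using rowmotion_nth[OF w(1,2) _ j False, of "\<lambda>i. y ! i"] rowmotion_nth[OF y(1,2) _ j False, of "\<lambda>i. y ! i"] by simp
      qed
    qed
  qed
  then show "rowmotion L z \<in> T" "ascents (rowmotion L z) = descents m n z"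
    "\<And>i. i \<in> descents m n z \<Longrightarrow> gap z i (rowmotion L z ! i)" using y by auto
qed

section \<open>Shifted noncrossing partitions\<close>

text \<open>
  With $N$ the set of positions that are not the largest of their block, the excess is zero between
  an element and its successor and negative on intervals that contain the tail of each of their
  blocks; so $N$ determines the successor function.
\<close>

definition excess :: "nat set \<Rightarrow> nat \<Rightarrow> nat \<Rightarrow> int" where
  "excess N x y = int M * int (card (N \<inter> {x..<y})) - (int y - int x)"

lemma excess_add: assumes "x \<le> y" "y \<le> z" shows "excess N x z = excess N x y + excess N y z"
proof -
  have "N \<inter> {x..<z} = (N \<inter> {x..<y}) \<union> (N \<inter> {y..<z})" using assms by auto
  moreover have "card ((N \<inter> {x..<y}) \<union> (N \<inter> {y..<z})) = card (N \<inter> {x..<y}) + card (N \<inter> {y..<z})"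
    by (intro card_Un_disjoint) auto
  ultimately show ?thesis unfolding excess_def by (simp add: algebra_simps)
qed

lemma excess_same [simp]: "excess N x x = 0" by (simp add: excess_def)

lemma excess_Suc: "excess N x (x + 1) = (if x \<in> N then int M - 1 else -1)"
proof -
  have "N \<inter> {x..<x + 1} = (if x \<in> N then {x} else {})" by auto
  then show ?thesis unfolding excess_def by simp
qed

text \<open>Closure is asked only to the right, so that it survives cutting points off the left end,
  which is how the inductions below proceed.\<close>

definition upclosed :: "nat set set \<Rightarrow> nat \<Rightarrow> nat \<Rightarrow> bool" where
  "upclosed P x y \<longleftrightarrow> (\<forall>B \<in> P. \<forall>i \<in> B. \<forall>j \<in> B. x \<le> i \<and> i < y \<and> i \<le> j \<longrightarrow> j < y)"

lemma upclosedD: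
  "\<lbrakk>upclosed P x y; B \<in> P; i \<in> B; j \<in> B; x \<le> i; i < y; i \<le> j\<rbrakk> \<Longrightarrow> j < y"
  unfolding upclosed_def by blast

lemma upclosed_mono: "upclosed P x y \<Longrightarrow> x \<le> x' \<Longrightarrow> upclosed P x' y"
  unfolding upclosed_def by (intro ballI impI) (elim conjE, drule (1) bspec, drule (1) bspec, drule (1) bspec, simp)

text \<open>The block count of \<open>ShNC\<close> is kept apart: the excess inequalities come from
  the conditions here, and the count then forces equality on arcs.\<close>

definition shifted :: "nat set set \<Rightarrow> bool" where
  "shifted P \<longleftrightarrow> partition_on {1..M * n} P \<and> noncrossing P \<and> (\<forall>B \<in> P. \<forall>i \<in> B. \<forall>j \<in> B. [i = j] (mod M))"

lemma ShNC_shifted: "P \<in> ShNC m n \<longleftrightarrow> shifted P \<and> card P = m * n + 1"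
  unfolding ShNC_def shifted_def m_plus_1 by auto

lemma opener_succ:
  assumes "partition_on {1..M * n} P" "i \<in> openers P"
  obtains B j where "B \<in> P" "i \<in> B" "is_successor B i j"
proof -
  obtain B where B: "B \<in> P" "i \<in> B" "\<exists>x. x \<in> B \<and> i < x" using assms unfolding openers_def by blast
  define j where "j = (LEAST x. x \<in> B \<and> i < x)"
  have "j \<in> B \<and> i < j" unfolding j_def using B(3) by (rule LeastI_ex)
  moreover have "j \<le> x" if "x \<in> B" "i < x" for x unfolding j_def using that by (intro Least_le) simp
  ultimately show ?thesis using that B unfolding is_successor_def by blast
qed

text \<open>A block other than \<open>B\<close> that meets the interior and continues past
  \<open>j\<close> would cross \<open>B\<close>, and \<open>B\<close> itself has no element between
  \<open>i\<close> and \<open>j\<close>.\<close>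

lemma upclosed_interior:
  assumes P: "shifted P" and B: "B \<in> P" "i \<in> B" "is_successor B i j" and x: "i < x" "x \<le> j"
  shows "upclosed P x j"
  unfolding upclosed_def
proof (intro ballI impI, rule ccontr)
  fix C p q assume C: "C \<in> P" "p \<in> C" "q \<in> C" "x \<le> p \<and> p < j \<and> p \<le> q" "\<not> q < j"
  have pt: "partition_on {1..M * n} P" using P unfolding shifted_def by simp
  have s: "j \<in> B" "i < j" "\<And>y. y \<in> B \<Longrightarrow> i < y \<Longrightarrow> j \<le> y" using B(3) unfolding is_successor_def by auto
  have "p \<notin> B" using s(3)[of p] C x by auto
  then have ne: "C \<noteq> B" using C by auto
  then have "q \<noteq> j" using partition_block_eq[OF pt C(1) B(1)] C s by auto
  then have "i < p" "p < j" "j < q" using C x by auto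
  then have "crossing B C" unfolding crossing_def using B C s by blast
  then show False using P B C ne unfolding shifted_def noncrossing_def by blast
qed

lemma arc_dvd:
  assumes P: "shifted P" and B: "B \<in> P" "i \<in> B" "is_successor B i j"
  shows "int M dvd excess N i j" and "i + 2 \<le> j" and "j \<le> M * n" and "i \<ge> 1" and "i \<in> openers P"
proof -
  have s: "j \<in> B" "i < j" using B(3) unfolding is_successor_def by auto
  have "[int j = int i] (mod int M)" using P B s unfolding shifted_def by (auto simp: cong_int_iff)
  then have d: "int M dvd int j - int i" by (simp add: cong_iff_dvd_diff)
  then show "int M dvd excess N i j" unfolding excess_def by simp
  have "int M \<le> int j - int i" using d s by (intro zdvd_imp_le) auto
  then show "i + 2 \<le> j" using M_ge_2 by linarith
  have "B \<subseteq> {1..M * n}" using P B partition_onD1 unfolding shifted_def by blast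
  then show "j \<le> M * n" "i \<ge> 1" using s B by auto
  show "i \<in> openers P" unfolding openers_def using B s by auto
qed

lemma dvd_le: "int M dvd g \<Longrightarrow> g < k * int M + int M \<Longrightarrow> g \<le> k * int M"
proof -
  assume "int M dvd g" "g < k * int M + int M"
  then obtain q where q: "g = int M * q" by blast
  then have "int M * q < int M * (k + 1)" using \<open>g < k * int M + int M\<close> by (simp add: algebra_simps)
  then have "q < k + 1" using M_pos by simp
  then have "int M * q \<le> int M * k" using M_pos by simp
  then show ?thesis using q by (simp add: algebra_simps)
qed

text \<open>Split off the first position. If it is no opener, it contributes -1. If it is an opener
  with successor \<open>x'\<close>, the interior of its arc has excess at most -1 and the opener
  adds \<open>M - 1\<close>; the sum is below \<open>M\<close> and divisible by \<open>M\<close>,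
  hence at most 0, and the rest from \<open>x'\<close> on is negative.\<close>

lemma excess_upclosed_neg:
  assumes P: "shifted P"
  shows "x < y \<Longrightarrow> 1 \<le> x \<Longrightarrow> y \<le> M * n + 1 \<Longrightarrow> upclosed P x y \<Longrightarrow> excess (openers P) x y \<le> -1"
proof (induction "y - x" arbitrary: x y rule: less_induct)
  case less
  have pt: "partition_on {1..M * n} P" using P unfolding shifted_def by simp
  let ?N = "openers P"
  show ?case
  proof (cases "x \<in> ?N")
    case False
    then have e: "excess ?N x y = -1 + excess ?N (x + 1) y" using excess_add[of x "x + 1" y ?N] less.prems excess_Suc by simp
    show ?thesis
    proof (cases "x + 1 = y")
      case True then show ?thesis using e by simp
    next
      case False
      have "upclosed P (x + 1) y" using upclosed_mono less.prems by simp
      moreover have "y - (x + 1) < y - x" using less.prems by linarith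
      ultimately show ?thesis using e less.hyps[of y "x + 1"] less.prems False by simp
    qed
  next
    case True
    obtain B x' where B: "B \<in> P" "x \<in> B" "is_successor B x x'" using opener_succ[OF pt True] .
    have s: "x' \<in> B" "x < x'" using B(3) unfolding is_successor_def by auto
    have x'y: "x' < y" using upclosedD[OF less.prems(4) B(1,2) s(1)] less.prems(1) s(2) by simp
    have x2: "x + 2 \<le> x'" using arc_dvd(2)[OF P B] .
    have "excess ?N (x + 1) x' \<le> -1"
      using less.hyps[of x' "x + 1"] less.prems x'y x2 upclosed_interior[OF P B, of "x + 1"] by simp
    then have "excess ?N x x' < int M" using excess_add[of x "x + 1" x' ?N] x2 True excess_Suc[of ?N x] by simp
    then have "excess ?N x x' \<le> 0" using dvd_le[of "excess ?N x x'" 0] arc_dvd(1)[OF P B] by simp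
    moreover have "upclosed P x' y" using upclosed_mono[of P x y x'] less.prems s by simp
    then have "excess ?N x' y \<le> -1" using less.hyps[of y x'] less.prems x'y s by simp
    ultimately show ?thesis using excess_add[of x x' y ?N] x'y s by simp
  qed
qed

lemma arc_nonpos:
  assumes P: "shifted P" and B: "B \<in> P" "i \<in> B" "is_successor B i j"
  shows "excess (openers P) i j \<le> 0"
proof -
  note a = arc_dvd[OF P B]
  have "excess (openers P) (i + 1) j \<le> -1" using excess_upclosed_neg[OF P, of "i + 1" j] a(2-5)
      upclosed_interior[OF P B, of "i + 1"] by simp
  then have "excess (openers P) i j < int M" using excess_add[of i "i + 1" j "openers P"] a(2,5) excess_Suc[of _ i] by simp
  then show ?thesis using dvd_le[of "excess (openers P) i j" 0] a(1) by simp
qed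

text \<open>
  An arc of nonzero excess would push the total below $-M$, contradicting the block count.
\<close>

lemma excess_upclosed_defect:
  assumes P: "shifted P" and A: "A \<in> P" "i \<in> A" "is_successor A i j" and ne: "excess (openers P) i j \<noteq> 0"
  shows "x \<le> i \<Longrightarrow> i < y \<Longrightarrow> 1 \<le> x \<Longrightarrow> y \<le> M * n + 1 \<Longrightarrow> upclosed P x y \<Longrightarrow> excess (openers P) x y < - int M"
proof (induction "y - x" arbitrary: x y rule: less_induct)
  case less
  have pt: "partition_on {1..M * n} P" using P unfolding shifted_def by simp
  let ?N = "openers P"
  have sA: "j \<in> A" "i < j" using A(3) unfolding is_successor_def by auto
  have jy: "j < y" using upclosedD[OF less.prems(5) A(1,2) sA(1)] less.prems(1,2) sA(2) by simp
  show ?case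
  proof (cases "x = i")
    case True
    have "excess ?N i j < 0" using arc_nonpos[OF P A] ne by simp
    then have "excess ?N i j \<le> - int M" using dvd_le[of "excess ?N i j" "-1"] arc_dvd(1)[OF P A] by simp
    moreover have "upclosed P j y" using upclosed_mono[of P x y j] less.prems sA by simp
    then have "excess ?N j y \<le> -1" using excess_upclosed_neg[OF P, of j y] less.prems sA jy by simp
    ultimately show ?thesis using excess_add[of i j y ?N] sA jy True by simp
  next
    case xi: False
    then have xi: "x < i" using less.prems by simp
    show ?thesis
    proof (cases "x \<in> ?N")
      case False
      then have e: "excess ?N x y = -1 + excess ?N (x + 1) y" using excess_add[of x "x + 1" y ?N] less.prems excess_Suc by simp
      have "upclosed P (x + 1) y" using upclosed_mono less.prems by simp
      moreover have "y - (x + 1) < y - x" using less.prems by linarith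
      ultimately show ?thesis using e less.hyps[of y "x + 1"] less.prems xi by simp
    next
      case True
      obtain B x' where B: "B \<in> P" "x \<in> B" "is_successor B x x'" using opener_succ[OF pt True] .
      have s: "x' \<in> B" "x < x'" using B(3) unfolding is_successor_def by auto
      have x'y: "x' < y" using upclosedD[OF less.prems(5) B(1,2) s(1)] less.prems(2) xi s(2) by simp
      have x2: "x + 2 \<le> x'" using arc_dvd(2)[OF P B] .
      have up: "upclosed P x' y" using upclosed_mono[of P x y x'] less.prems s by simp
      have e: "excess ?N x y = excess ?N x x' + excess ?N x' y" using excess_add[of x x' y ?N] x'y s by simp
      show ?thesis
      proof (cases "x' \<le> i")
        case True
        then have "excess ?N x' y < - int M" using less.hyps[of y x'] less.prems x'y s up by simp
        then show ?thesis using e arc_nonpos[OF P B] by simp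
      next
        case False
        \<comment> \<open>The arc of nonzero excess starts under the arc from \<open>x\<close> to
          \<open>x'\<close>; adding \<open>M - 1\<close> to the interior leaves a negative multiple
          of \<open>M\<close>, thus at most \<open>- M\<close>.\<close>
        then have "excess ?N (x + 1) x' < - int M"
          using less.hyps[of x' "x + 1"] less.prems x'y xi x2 upclosed_interior[OF P B, of "x + 1"] by simp
        then have "excess ?N x x' < 0" using excess_add[of x "x + 1" x' ?N] x2 True excess_Suc[of ?N x] by simp
        then have "excess ?N x x' \<le> - int M" using dvd_le[of "excess ?N x x'" "-1"] arc_dvd(1)[OF P B] by simp
        moreover have "excess ?N x' y \<le> -1" using excess_upclosed_neg[OF P, of x' y] less.prems x'y s up by simp
        ultimately show ?thesis using e by simp
      qed
    qed
  qed
qed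

section \<open>Consequences of the block count\<close>

lemma shifted_subset: "shifted P \<Longrightarrow> B \<in> P \<Longrightarrow> B \<subseteq> {1..M * n}"
  unfolding shifted_def using partition_onD1 by blast

lemma upclosed_top: "shifted P \<Longrightarrow> upclosed P x (M * n + 1)"
  unfolding upclosed_def by (auto dest!: shifted_subset simp: less_Suc_eq_le)

lemma openers_subset: "shifted P \<Longrightarrow> openers P \<subseteq> {1..<M * n}"
proof
  fix i assume P: "shifted P" and i: "i \<in> openers P"
  then obtain B x where "B \<in> P" "i \<in> B" "x \<in> B" "i < x" unfolding openers_def by blast
  moreover have "B \<subseteq> {1..M * n}" using P calculation(1) partition_onD1 unfolding shifted_def by blast
  ultimately show "i \<in> {1..<M * n}" by auto
qed

lemma ShNC_card_openers:
  assumes "P \<in> ShNC m n" shows "card (openers P) = n - 1"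
proof -
  have "card P + card (openers P) = card {1..M * n}"
    using assms card_openers[of "{1..M * n}" P] unfolding ShNC_shifted shifted_def by simp
  moreover have "M * n = m * n + n" using m_plus_1 by (simp flip: m_plus_1)
  ultimately show ?thesis using assms unfolding ShNC_shifted by simp
qed

lemma excess_total:
  assumes "P \<in> ShNC m n" shows "excess (openers P) 1 (M * n + 1) = - int M"
proof -
  have "openers P \<inter> {1..<M * n + 1} = openers P"
    using openers_subset[of P] assms unfolding ShNC_shifted by auto
  then have "excess (openers P) 1 (M * n + 1) = int M * (int n - 1) - int M * int n"
    unfolding excess_def using ShNC_card_openers[OF assms] n_pos by simp
  then show ?thesis by (simp add: algebra_simps)
qed

lemma arc_zero:
  assumes S: "P \<in> ShNC m n" and B: "B \<in> P" "i \<in> B" "is_successor B i j"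
  shows "excess (openers P) i j = 0"
proof (rule ccontr)
  assume ne: "excess (openers P) i j \<noteq> 0"
  have P: "shifted P" using S ShNC_shifted by simp
  have "excess (openers P) 1 (M * n + 1) < - int M"
    using excess_upclosed_defect[OF P B ne, of 1 "M * n + 1"] arc_dvd(2-5)[OF P B] upclosed_top[OF P] by simp
  then show False using excess_total[OF S] by simp
qed

text \<open>An earlier zero \<open>k\<close> would leave excess zero between \<open>k\<close> and
  \<open>j\<close>, on an interval whose excess is negative. So the openers alone determine the
  successor.\<close>

lemma arc_least:
  assumes S: "P \<in> ShNC m n" and B: "B \<in> P" "i \<in> B" "is_successor B i j"
  shows "(LEAST j. i < j \<and> excess (openers P) i j = 0) = j"
proof (rule Least_equality)
  have P: "shifted P" using S ShNC_shifted by simp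
  show "i < j \<and> excess (openers P) i j = 0" using arc_zero[OF assms] arc_dvd(2)[OF P B] by simp
  fix k assume k: "i < k \<and> excess (openers P) i k = 0"
  show "j \<le> k"
  proof (rule ccontr)
    assume "\<not> j \<le> k"
    then have kj: "k < j" by simp
    have "excess (openers P) k j \<le> -1"
      using excess_upclosed_neg[OF P, of k j] kj k arc_dvd(2-5)[OF P B] upclosed_interior[OF P B, of k] by simp
    moreover have "excess (openers P) i j = excess (openers P) i k + excess (openers P) k j" using excess_add[of i k j] k kj by simp
    ultimately show False using k arc_zero[OF assms] by simp
  qed
qed

lemma ShNC_follows:
  assumes S: "P \<in> ShNC m n"
  shows "follows (\<lambda>i. if i \<in> openers P then Some (LEAST j. i < j \<and> excess (openers P) i j = 0) else None) {1..M * n} P"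
  unfolding follows_def
proof (intro conjI ballI allI impI)
  have P: "shifted P" using S ShNC_shifted by simp
  then show pt: "partition_on {1..M * n} P" unfolding shifted_def by simp
  fix B i assume B: "B \<in> P" "i \<in> B"
  have "i \<notin> openers P \<longleftrightarrow> (\<forall>x \<in> B. x \<le> i)"
  proof
    assume "i \<notin> openers P"
    then show "\<forall>x \<in> B. x \<le> i" using B unfolding openers_def by (metis (mono_tags, lifting) mem_Collect_eq not_le)
  next
    assume H: "\<forall>x \<in> B. x \<le> i"
    show "i \<notin> openers P"
    proof
      assume "i \<in> openers P"
      then obtain C x where C: "C \<in> P" "i \<in> C" "x \<in> C" "i < x" unfolding openers_def by blast
      then have "C = B" using partition_block_eq[OF pt _ B(1) _ B(2)] by blast
      then show False using C H by fastforce
    qed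
  qed
  then show "((if i \<in> openers P then Some (LEAST j. i < j \<and> excess (openers P) i j = 0) else None) = None) = (\<forall>x\<in>B. x \<le> i)"
    by (metis option.distinct(1))
  fix j assume "(if i \<in> openers P then Some (LEAST j. i < j \<and> excess (openers P) i j = 0) else None) = Some j"
  then have i: "i \<in> openers P" and j: "j = (LEAST j. i < j \<and> excess (openers P) i j = 0)"
    by (metis option.distinct(1), metis option.distinct(1) option.inject)
  obtain B' j' where B': "B' \<in> P" "i \<in> B'" "is_successor B' i j'" using opener_succ[OF pt i] .
  have "j' = j" unfolding j using arc_least[OF S B'] by (rule sym)
  moreover have "B' = B" using partition_block_eq[OF pt B'(1) B(1) B'(2) B(2)] .
  ultimately show "is_successor B i j" using B'(3) by blast
qed

lemma ShNC_eqI: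
  assumes "P \<in> ShNC m n" "Q \<in> ShNC m n" "openers P = openers Q" shows "P = Q"
  by (rule follows_unique[OF ShNC_follows[OF assms(1), unfolded assms(3)] ShNC_follows[OF assms(2)]])

text \<open>The excess from \<open>j\<close> to the end is negative and the total is
  \<open>- M\<close>, so the excess before \<open>j\<close> is at least \<open>1 - M\<close>. The
  summand 1 stands for position 1, a first occurrence that is not the shift of an opener.\<close>

lemma openers_ballot:
  assumes S: "P \<in> ShNC m n" and j: "1 \<le> j" "j \<le> M * n"
  shows "row j \<le> 1 + card (openers P \<inter> {1..<j})"
proof -
  have P: "shifted P" using S ShNC_shifted by simp
  have "excess (openers P) j (M * n + 1) \<le> -1" using excess_upclosed_neg[OF P, of j] j upclosed_top[OF P] by simp
  then have "excess (openers P) 1 j \<ge> 1 - int M" using excess_total[OF S] excess_add[of 1 j "M * n + 1" "openers P"] j by simp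
  then have "int j \<le> int M * (1 + int (card (openers P \<inter> {1..<j})))" unfolding excess_def by (simp add: algebra_simps)
  then have "int j \<le> int (M * (1 + card (openers P \<inter> {1..<j})))" by (simp add: algebra_simps)
  then have "j \<le> M * (1 + card (openers P \<inter> {1..<j}))" by (simp only: zle_int)
  then show ?thesis using row_le_iff by blast
qed

section \<open>The map Psi\<close>

definition initials :: "nat list \<Rightarrow> nat set" where
  "initials b = {i \<in> {1..M * n}. first_occ b i}"

lemma first_occ_exists:
  assumes b: "b \<in> T" and v: "1 \<le> v" "v \<le> n"
  obtains i where "i \<in> initials b" "b ! i = v" "i \<le> M * v"
proof -
  define i where "i = (LEAST i. b ! i = v)"
  have bv: "b ! (M * v) = v" using T_mult[OF b v(2)] .
  have i: "b ! i = v" "i \<le> M * v" unfolding i_def using bv by (auto intro: LeastI Least_le)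
  have b0: "b ! 0 = 0" using T_mult[OF b, of 0] by simp
  have "i \<noteq> 0" using i(1) b0 v by (intro notI) simp
  moreover have "i \<le> M * n" using i(2) v(2) mult_le_mono2[of v n M] by linarith
  moreover have "first_occ b i" unfolding first_occ_def i(1) unfolding i_def using not_less_Least by blast
  ultimately show ?thesis using that[of i] i unfolding initials_def by simp
qed

lemma initials_inj: "inj_on ((!) b) (initials b)"
proof (rule inj_onI)
  fix i j assume "i \<in> initials b" "j \<in> initials b" "b ! i = b ! j"
  then have "\<not> i < j" "\<not> j < i" unfolding initials_def first_occ_def by (metis (mono_tags, lifting) mem_Collect_eq)+
  then show "i = j" by simp
qed

lemma T_pos: "b \<in> T \<Longrightarrow> 1 \<le> i \<Longrightarrow> i \<le> M * n \<Longrightarrow> 1 \<le> b ! i"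
  using T_row[of b i] row_pos[of i] by simp

lemma card_initials: assumes b: "b \<in> T" shows "card (initials b) = n"
proof -
  have "(!) b ` initials b = {1..n}"
  proof (rule Set.set_eqI, rule iffI)
    fix v assume "v \<in> (!) b ` initials b"
    then show "v \<in> {1..n}" using T_pos[OF b] T_upper[OF b] unfolding initials_def by auto
  next
    fix v assume "v \<in> {1..n}"
    then show "v \<in> (!) b ` initials b" using first_occ_exists[OF b, of v] by auto
  qed
  then show ?thesis using card_image[OF initials_inj, of b] by simp
qed

lemma len_pos: "1 \<le> M * n" "M \<le> M * n"
  using M_pos n_pos by auto

lemma one_initial: assumes b: "b \<in> T" shows "1 \<in> initials b"
proof -
  have "b ! 0 = 0" using T_mult[OF b, of 0] by simp
  then show ?thesis using T_pos[OF b, of 1] len_pos unfolding initials_def first_occ_def by auto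
qed

text \<open>An earlier occurrence of the value at \<open>i + 1\<close> would reach past
  \<open>i\<close> and force \<open>b ! i \<le> b ! (i + 1)\<close>. With this, both cases of
  \<open>phi\<close> have the same condition.\<close>

lemma descents_first_occ:
  assumes b: "b \<in> T" and i: "i < M * n" "\<not> M dvd i"
  shows "i \<in> descents m n b \<longleftrightarrow> first_occ b (i + 1)"
proof
  assume d: "i \<in> descents m n b"
  have "b ! j \<noteq> b ! (i + 1)" if j: "j < i + 1" for j
  proof
    assume e: "b ! j = b ! (i + 1)"
    have lt: "b ! (i + 1) < b ! i" using d descents_iff by simp
    then have "j < i" using j e by (cases "j = i") auto
    moreover have "i + 1 \<le> M * b ! j" using T_lower[OF b, of "i + 1"] i e by simp
    ultimately have "b ! i \<le> b ! j" using T_nest[OF b, of j i] i by simp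
    then show False using e lt by simp
  qed
  then show "first_occ b (i + 1)" unfolding first_occ_def by blast
next
  assume "first_occ b (i + 1)"
  then have "b ! i \<noteq> b ! (i + 1)" unfolding first_occ_def by simp
  then have "b ! (i + 1) < b ! i" using T_Suc_le[OF b _ i(2)] i by simp
  then show "i \<in> descents m n b" using i descents_iff by simp
qed

section \<open>The arcs of phi\<close>

definition next_cong :: "nat list \<Rightarrow> nat \<Rightarrow> nat" where
  "next_cong b i = (LEAST j. j \<in> {1..M * n} \<and> i < j \<and> [j = i] (mod M) \<and> b ! j = b ! i)"

lemma phi_eq:
  assumes b: "b \<in> T" and i: "i \<in> {1..M * n}"
  shows "phi m n b i = (if i < M * n \<and> first_occ b (i + 1)
     then Some (if M dvd i then M * b ! (i + 1) else next_cong b i) else None)"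
proof -
  have k: "(\<exists>k. k_initial b k (i + 1)) \<longleftrightarrow> first_occ b (i + 1)"
    unfolding k_initial_def first_occ_def by auto
  consider "M dvd i" | "\<not> M dvd i" "i < M * n" using less_mult_if_not_dvd[of i n] i by auto
  then show ?thesis
  proof cases
    case 1
    then have "i \<notin> descents m n b" using descent_not_dvd[OF b] by blast
    then show ?thesis using 1 unfolding phi_def m_plus_1 k by auto
  next
    case 2
    then show ?thesis using descents_first_occ[OF b 2(2,1)]
      unfolding phi_def m_plus_1 k next_cong_def by auto
  qed
qed

lemma next_cong_props:
  assumes b: "b \<in> T" and d: "i \<in> descents m n b"
  shows "next_cong b i \<in> {1..M * n}" "i < next_cong b i" "[next_cong b i = i] (mod M)"
    "b ! next_cong b i = b ! i"
    and "\<And>j. i < j \<Longrightarrow> j \<le> M * n \<Longrightarrow> [j = i] (mod M) \<Longrightarrow> b ! j = b ! i \<Longrightarrow> next_cong b i \<le> j"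
proof -
  let ?Q = "\<lambda>j. j \<in> {1..M * n} \<and> i < j \<and> [j = i] (mod M) \<and> b ! j = b ! i"
  have nd: "\<not> M dvd i" using descent_not_dvd[OF b d] .
  have i: "i < M * n" "b ! (i + 1) < b ! i" using d descents_iff by auto
  have "i \<noteq> 0" using nd by (intro notI) simp
  define k where "k = b ! i"
  define s where "s = row i - 1"
  have cs: "row i = s + 1" using row_pos[of i] \<open>i \<noteq> 0\<close> s_def by simp
  have s: "M * s < i" "i < M * (s + 1)" using cs row_eq_iff[of i s] less_mult_if_not_dvd[OF nd, of "s + 1"] by blast+
  have "s + 1 \<le> b ! (i + 1)" using T_row[OF b, of "i + 1"] i row_Suc_not_mult[OF nd] cs by simp
  then have sk: "s + 2 \<le> k" using i k_def by simp
  \<comment> \<open>The position of row \<open>k\<close> with the residue of \<open>i\<close>: its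
    entry is at least \<open>k\<close> by its row, and at most \<open>k\<close> by nesting under
    \<open>i\<close>.\<close>
  define j where "j = M * (k - 1) + (i - M * s)"
  have k1: "M * (s + 1) \<le> M * (k - 1)" using sk by (intro mult_le_mono2) simp
  have kn: "M * k \<le> M * n" using T_val_le[OF b, of i] i k_def by simp
  have Mk: "M * k = M * (k - 1) + M" using sk by (cases k) auto
  have ij: "i < j" using s k1 unfolding j_def by linarith
  have jk: "j \<le> M * k" using s Mk unfolding j_def by simp
  have "row j = k" using row_eq_iff[of j "k - 1"] jk s sk unfolding j_def by auto
  then have "k \<le> b ! j" using T_row[OF b, of j] jk kn by simp
  moreover have "b ! j \<le> k" using T_nest[OF b _ ij] jk i k_def by simp
  ultimately have bj: "b ! j = b ! i" using k_def by simp
  have "[M * (k - 1) + (i - M * s) = M * s + (i - M * s)] (mod M)"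
    by (intro cong_add) (auto simp: cong_def)
  then have cg: "[j = i] (mod M)" using s unfolding j_def by simp
  have "j \<le> M * n" using jk kn by (rule le_trans)
  then have Q: "?Q j" using ij bj cg by simp
  have "?Q (next_cong b i)" unfolding next_cong_def using Q by (rule LeastI)
  then show "next_cong b i \<in> {1..M * n}" "i < next_cong b i" "[next_cong b i = i] (mod M)"
    "b ! next_cong b i = b ! i" by auto
  fix j assume "i < j" "j \<le> M * n" "[j = i] (mod M)" "b ! j = b ! i"
  then show "next_cong b i \<le> j" unfolding next_cong_def by (intro Least_le) simp
qed

lemma phi_cases:
  assumes b: "b \<in> T" and i: "i \<in> {1..M * n}" and j: "phi m n b i = Some j"
  obtains (mult) "M dvd i" "i < M * n" "first_occ b (i + 1)" "j = M * b ! (i + 1)" "i + 1 \<le> j"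
  | (descent) "\<not> M dvd i" "i \<in> descents m n b" "j = next_cong b i"
proof (cases "M dvd i")
  case True
  then have "i < M * n" "first_occ b (i + 1)" "j = M * b ! (i + 1)"
    using phi_eq[OF b i] j by (auto split: if_splits)
  then show ?thesis using mult True T_lower[OF b, of "i + 1"] by simp
next
  case False
  then have "i < M * n" "first_occ b (i + 1)" "j = next_cong b i"
    using phi_eq[OF b i] j by (auto split: if_splits)
  then show ?thesis using descent False descents_first_occ[OF b] by simp
qed

lemma phi_Some:
  assumes b: "b \<in> T" and i: "i \<in> {1..M * n}" and j: "phi m n b i = Some j"
  shows "j \<in> {1..M * n} \<and> i < j" and "[j = i] (mod M)"
proof -
  have "j \<in> {1..M * n} \<and> i < j \<and> [j = i] (mod M)" using b i j
  proof (cases rule: phi_cases)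
    case mult
    then have "j \<le> M * n" "1 \<le> j" using T_val_le[OF b, of "i + 1"] i by (simp, linarith)
    then show ?thesis using mult by (auto simp: cong_def)
  next
    case descent
    then show ?thesis using next_cong_props[OF b descent(2)] by simp
  qed
  then show "j \<in> {1..M * n} \<and> i < j" "[j = i] (mod M)" by auto
qed

text \<open>Equal images force equal residues. For multiples of \<open>M\<close>, the entries
  following the two positions agree, so the later one is no first occurrence; for descents, the
  later position is itself a candidate for the successor of the earlier one.\<close>

lemma phi_inj:
  assumes b: "b \<in> T" and i: "i \<in> {1..M * n}" and j: "j \<in> {1..M * n}"
    and ik: "phi m n b i = Some k" and jk: "phi m n b j = Some k"
  shows "i = j"
proof -
  have no: "\<not> i < j" if i: "i \<in> {1..M * n}" and j: "j \<in> {1..M * n}"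
    and ik: "phi m n b i = Some k" and jk: "phi m n b j = Some k" for i j
  proof
    assume lt: "i < j"
    have "[i = j] (mod M)" using phi_Some(2)[OF b i ik] phi_Some(2)[OF b j jk] by (metis cong_sym cong_trans)
    then have dv: "M dvd i \<longleftrightarrow> M dvd j" by (metis cong_dvd_iff cong_sym)
    show False using b i ik
    proof (cases rule: phi_cases)
      case mult
      then have "first_occ b (j + 1)" "k = M * b ! (j + 1)"
        using b j jk dv by (auto elim: phi_cases)
      moreover have "b ! (i + 1) = b ! (j + 1)" using mult(4) calculation M_pos by simp
      ultimately show False using lt unfolding first_occ_def by simp
    next
      case descent
      then have dj: "j \<in> descents m n b" "k = next_cong b j"
        using b j jk dv by (auto elim: phi_cases)
      have "b ! j = b ! i" using next_cong_props(4)[OF b descent(2)] next_cong_props(4)[OF b dj(1)]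
          descent(3) dj(2) by simp
      then have "next_cong b i \<le> j" using next_cong_props(5)[OF b descent(2) lt] j cong_sym[OF \<open>[i = j] (mod M)\<close>] by simp
      then show False using next_cong_props(2)[OF b dj(1)] descent(3) dj(2) by simp
    qed
  qed
  then show ?thesis using no[OF i j ik jk] no[OF j i jk ik] by simp
qed

lemma descent_row:
  assumes b: "b \<in> T" and d: "i \<in> descents m n b" and c: "row j = row i" and lt: "i < j"
  shows "b ! j < b ! i"
proof -
  have nd: "\<not> M dvd i" using descent_not_dvd[OF b d] .
  have i: "i < M * n" "b ! (i + 1) < b ! i" using d descents_iff by auto
  have "row (i + 1) \<le> b ! (i + 1)" using T_row[OF b] i by simp
  then have "row j \<le> b ! (i + 1)" using c row_Suc_not_mult[OF nd] by simp
  then have "b ! j \<le> b ! (i + 1)" using T_nest_le[OF b, of "i + 1" j] lt i row_le_iff by simp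
  then show ?thesis using i by simp
qed

lemma cong_row:
  assumes "[j = i] (mod M)" "0 < i" "0 < j"
  shows "j + M * row i = i + M * row j"
proof -
  \<comment> \<open>Row \<open>s + 1\<close> consists of the positions \<open>M * s + 1\<close> to
    \<open>M * (s + 1)\<close>, so the offset within a row is read off from
    \<open>x - 1\<close>.\<close>
  have *: "x = M * (row x - 1) + ((x - 1) mod M + 1)" if x: "0 < x" for x
  proof -
    have "x + m = (x - 1) + M" using m_plus_1 x by linarith
    then have "row x = (x - 1) div M + 1" unfolding row_def using M_pos by (metis div_add_self2 less_irrefl)
    then show ?thesis using x by simp
  qed
  have "[j - 1 = i - 1] (mod M)" using assms cong_add_rcancel_nat[of "j - 1" 1 "i - 1" M] by simp
  then have "(j - 1) mod M = (i - 1) mod M" unfolding cong_def .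
  then have "j + M * (row i - 1) = i + M * (row j - 1)" using *[of i] *[of j] assms by linarith
  moreover obtain a c where "row i = Suc a" "row j = Suc c"
    using row_pos assms(2,3) gr0_implies_Suc by metis
  ultimately show ?thesis by simp
qed

lemma row_shift: "row (i + M * t) = row i + t"
proof -
  have "i + M * t + m = (i + m) + M * t" by simp
  then show ?thesis unfolding row_def using M_pos by (metis div_mult_self2 add.commute less_irrefl)
qed

text \<open>The entry at \<open>p\<close> is bounded by \<open>b ! j\<close> because
  \<open>j\<close> reaches it, and it bounds \<open>b ! q = b ! j\<close> because \<open>p\<close>
  and \<open>q\<close> share a row.\<close>

lemma val_const_in_row:
  assumes b: "b \<in> T" and q: "q \<le> M * n" and p: "0 < p" "p \<le> q" "row p = row q" and j: "j < p" "q \<le> M * b ! j" "b ! q = b ! j"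
  shows "b ! p = b ! j"
proof -
  have "b ! p \<le> b ! j" using T_nest[OF b, of j p] j p q by simp
  moreover have "p \<le> M * n" using p q by simp
  moreover have "row q \<le> b ! p" using T_row[OF b, of p] p calculation by simp
  then have "q \<le> M * b ! p" using row_le_iff by simp
  then have "b ! q \<le> b ! p" using T_nest_le[OF b, of p q] p calculation by simp
  ultimately show ?thesis using j by simp
qed

text \<open>An arc from a multiple of \<open>M\<close> ends where the entry at \<open>i + 1\<close>
  stops reaching, and reaches are nested by (III). Under an arc between equal entries, every smaller
  entry stops reaching before \<open>j\<close>; only a descent \<open>i'\<close> with the same value
  needs a comparison of residues.\<close>

lemma phi_nested:
  assumes b: "b \<in> T" and i: "i \<in> {1..M * n}" and i': "i' \<in> {1..M * n}"
    and j: "phi m n b i = Some j" and j': "phi m n b i' = Some j'" and lt: "i < i'" "i' < j"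
  shows "j' \<le> j"
  using b i j
proof (cases rule: phi_cases)
  case mult
  show ?thesis using b i' j'
  proof (cases rule: phi_cases)
    case m': mult
    have "b ! (i' + 1) \<le> b ! (i + 1)" using T_nest_le[OF b, of "i + 1" "i' + 1"] lt mult by simp
    then show ?thesis using mult m' by simp
  next
    case descent
    have "b ! i' \<le> b ! (i + 1)" using T_nest_le[OF b, of "i + 1" i'] lt mult by simp
    then have "M * b ! i' \<le> j" using mult by simp
    moreover have "j' \<le> M * b ! i'"
      using T_lower[OF b, of j'] next_cong_props[OF b descent(2)] descent(3) by simp
    ultimately show ?thesis by simp
  qed
next
  case descent
  note nc = next_cong_props[OF b descent(2), folded descent(3)]
  have jM: "j \<le> M * b ! i" using T_lower[OF b, of j] nc by simp
  have small: "M * b ! p < j" if p: "i < p" "p \<le> j" "b ! p < b ! i" for p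
  proof (rule ccontr)
    assume "\<not> M * b ! p < j"
    then have "b ! j \<le> b ! p" using T_nest_le[OF b, of p j] p nc by simp
    then show False using nc p by simp
  qed
  show ?thesis using b i' j'
  proof (cases rule: phi_cases)
    case mult
    have "b ! (i' + 1) \<le> b ! i" using T_nest[OF b, of i "i' + 1"] lt jM i by simp
    moreover have "b ! (i' + 1) \<noteq> b ! i" using mult(3) lt unfolding first_occ_def by (metis less_Suc_eq Suc_eq_plus1)
    ultimately show ?thesis using small[of "i' + 1"] lt mult by simp
  next
    case d': descent
    note nc' = next_cong_props[OF b d'(2), folded d'(3)]
    have le: "b ! i' \<le> b ! i" using T_nest[OF b, of i i'] lt jM i by simp
    show ?thesis
    proof (cases "b ! i' = b ! i")
      case False
      then have "M * b ! i' < j" using small[of i'] lt le by simp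
      moreover have "j' \<le> M * b ! i'" using T_lower[OF b, of j'] nc' by simp
      ultimately show ?thesis by simp
    next
      case True
      have i0: "0 < i" "0 < i'" "0 < j" using i i' nc by auto
      have cij: "j + M * row i = i + M * row j" using cong_row[OF nc(3) i0(1,3)] .
      have ci: "row i < row i'"
      proof (rule ccontr)
        assume "\<not> row i < row i'"
        then have "row i' = row i" using row_mono[of i i'] lt by simp
        then show False using descent_row[OF b descent(2) _ lt(1)] True by simp
      qed
      have ci': "row i' < row j"
      proof (rule ccontr)
        assume "\<not> row i' < row j"
        then have "row j = row i'" using row_mono[of i' j] lt by simp
        then show False using descent_row[OF b d'(2) _ lt(2)] True nc(4) by simp
      qed
      \<comment> \<open>The row of \<open>i'\<close> has constant value up to \<open>i'\<close>, so \<open>p\<close>, the position congruent to \<open>i\<close>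
        in that row, lies beyond \<open>i'\<close>: otherwise \<open>j \<le> p\<close>. Hence \<open>i'\<close> has the smaller residue, and the
        row of \<open>j\<close> contains a candidate \<open>q < j\<close> for \<open>j'\<close>.\<close>
      define p where "p = i + M * (row i' - row i)"
      have pe: "p + M * row i = i + M * row i'" unfolding p_def diff_mult_distrib2 using mult_le_mono2[of "row i" "row i'" M] ci by linarith
      have cp: "row p = row i'" unfolding p_def row_shift using ci by simp
      have pi: "i < p" unfolding p_def using ci M_pos by simp
      have "i' < p"
      proof (rule ccontr)
        assume "\<not> i' < p"
        then have "b ! p = b ! i"
          using val_const_in_row[OF b, of i' p i] i' pi cp True lt jM by simp
        moreover have "[p = i] (mod M)" unfolding p_def by (simp add: cong_def)
        ultimately have "j \<le> p" using nc(5)[OF pi] \<open>\<not> i' < p\<close> i' by simp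
        then show False using lt \<open>\<not> i' < p\<close> by simp
      qed
      define q where "q = i' + M * (row j - row i')"
      have qe: "q + M * row i' = i' + M * row j" unfolding q_def diff_mult_distrib2 using mult_le_mono2[of "row i'" "row j" M] ci' by linarith
      have cq: "row q = row j" unfolding q_def row_shift using ci' by simp
      have qj: "q < j" using qe cij pe \<open>i' < p\<close> by linarith
      have iq: "i' < q" unfolding q_def using ci' M_pos by simp
      have "b ! q = b ! i'"
        using val_const_in_row[OF b, of j q i'] iq qj cq True nc jM by simp
      moreover have "[q = i'] (mod M)" unfolding q_def by (simp add: cong_def)
      ultimately have "j' \<le> q" using nc'(5)[OF iq] qj nc by simp
      then show ?thesis using qj by simp
    qed
  qed
qed

section \<open>The partition \<open>Psi m n b\<close> and its openers\<close>

lemma Psi_follows: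
  assumes b: "b \<in> T" shows "follows (phi m n b) {1..M * n} (Psi m n b)"
proof -
  obtain P where P: "follows (phi m n b) {1..M * n} P"
    using follows_exists[of "{1..M * n}" "phi m n b"] phi_Some(1)[OF b] phi_inj[OF b] by blast
  have "Psi m n b = (THE P. follows (phi m n b) {1..M * n} P)"
    unfolding Psi_def follows_def m_plus_1 ..
  also have "\<dots> = P" using P follows_unique by (intro the_equality) auto
  finally show ?thesis using P by simp
qed

lemma openers_Psi:
  assumes b: "b \<in> T" shows "openers (Psi m n b) = {i. 1 \<le> i \<and> i + 1 \<in> initials b}"
proof -
  have "phi m n b i \<noteq> None \<longleftrightarrow> i < M * n \<and> first_occ b (i + 1)" if "i \<in> {1..M * n}" for i
    using phi_eq[OF b that] by simp
  then have "{i \<in> {1..M * n}. phi m n b i \<noteq> None} = {i \<in> {1..M * n}. i < M * n \<and> first_occ b (i + 1)}"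
    by blast
  also have "\<dots> = {i. 1 \<le> i \<and> i + 1 \<in> initials b}"
  proof (rule Set.set_eqI)
    fix i
    show "i \<in> {i \<in> {1..M * n}. i < M * n \<and> first_occ b (i + 1)} \<longleftrightarrow> i \<in> {i. 1 \<le> i \<and> i + 1 \<in> initials b}"
      unfolding initials_def by (cases "i < M * n") simp_all
  qed
  finally show ?thesis unfolding openers_follows[OF Psi_follows[OF b]] .
qed

text \<open>Position 1 is always a first occurrence, but 0 belongs to no block; hence
  \<open>n\<close> first occurrences correspond to \<open>n - 1\<close> openers.\<close>

lemma initials_openers:
  assumes b: "b \<in> T" shows "initials b = insert 1 (Suc ` openers (Psi m n b))"
proof (rule Set.set_eqI, rule iffI)
  fix i assume i: "i \<in> initials b"
  then obtain j where j: "i = Suc j" unfolding initials_def by (cases i) auto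
  show "i \<in> insert 1 (Suc ` openers (Psi m n b))"
  proof (cases "j = 0")
    case False
    then have "j \<in> openers (Psi m n b)" unfolding openers_Psi[OF b] using i j by simp
    then show ?thesis using j by blast
  qed (simp add: j)
next
  fix i assume "i \<in> insert 1 (Suc ` openers (Psi m n b))"
  then consider "i = 1" | j where "i = Suc j" "j \<in> openers (Psi m n b)" by blast
  then show "i \<in> initials b"
  proof cases
    case 1
    then show ?thesis using one_initial[OF b] by simp
  next
    case 2
    then have "j + 1 \<in> initials b" unfolding openers_Psi[OF b] by blast
    then show ?thesis using 2 by simp
  qed
qed

lemma Psi_in_ShNC:
  assumes b: "b \<in> T" shows "Psi m n b \<in> ShNC m n"
proof -
  note F = Psi_follows[OF b]
  have pt: "partition_on {1..M * n} (Psi m n b)" using F unfolding follows_def by simp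
  have nc: "noncrossing (Psi m n b)" using follows_noncrossing[OF F] phi_nested[OF b] by blast
  have reach: "[i = j] (mod M)" if "(i, j) \<in> {(i, j). phi m n b i = Some j}\<^sup>*" "i \<in> {1..M * n}" for i j
  proof -
    have "[i = j] (mod M) \<and> j \<in> {1..M * n}" using that
    proof induction
      case (step y z)
      then show ?case using phi_Some[OF b, of y z] by (auto intro: cong_trans cong_sym)
    qed simp
    then show ?thesis by simp
  qed
  have cg: "[i = j] (mod M)" if B: "B \<in> Psi m n b" "i \<in> B" "j \<in> B" for B i j
  proof -
    have A: "i \<in> {1..M * n}" "j \<in> {1..M * n}" using B partition_onD1[OF pt] by blast+
    show ?thesis
    proof (cases "i \<le> j")
      case True
      then show ?thesis using follows_reach[OF F B] reach A by blast
    next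
      case False
      then show ?thesis using follows_reach[OF F B(1,3,2)] reach A cong_sym by (metis nat_le_linear)
    qed
  qed
  have "card (initials b) = card (openers (Psi m n b)) + 1"
  proof -
    have "finite (openers (Psi m n b))" using openers_follows[OF F] by simp
    moreover have "1 \<notin> Suc ` openers (Psi m n b)" by (auto simp: openers_Psi[OF b])
    ultimately show ?thesis unfolding initials_openers[OF b] by (simp add: card_image)
  qed
  then have "card (openers (Psi m n b)) + 1 = n" using card_initials[OF b] by simp
  moreover have "card (Psi m n b) + card (openers (Psi m n b)) = M * n"
    using card_openers[OF pt] by simp
  moreover have "M * n = m * n + n" by (simp flip: m_plus_1)
  ultimately have "card (Psi m n b) = m * n + 1" by linarith
  then show ?thesis unfolding ShNC_shifted shifted_def using pt nc cg by blast
qed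

section \<open>Recovering a vector from its first occurrences\<close>

text \<open>
  Scanning positions from the left, let each initial position open an arc and let $Mk$ close the
  innermost open arc after it. Then \<open>depth\<close> counts the arcs around the current one, and the value
  at $i$ is the $k$ for which $Mk$ closes the arc that is innermost at $i$.
\<close>

definition depth :: "nat set \<Rightarrow> nat \<Rightarrow> int" where
  "depth S i = int (card (S \<inter> {1..i})) - int (row i)"

lemma card_split:
  fixes x y :: nat
  assumes "x \<le> y" shows "card (S \<inter> {1..y}) = card (S \<inter> {1..x}) + card (S \<inter> {x<..y})"
proof -
  have "S \<inter> {1..y} = (S \<inter> {1..x}) \<union> (S \<inter> {x<..y})" using assms by auto
  moreover have "card ((S \<inter> {1..x}) \<union> (S \<inter> {x<..y})) = card (S \<inter> {1..x}) + card (S \<inter> {x<..y})"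
    by (intro card_Un_disjoint) auto
  ultimately show ?thesis by simp
qed

text \<open>With \<open>k = b ! i\<close>, the values first occurring between \<open>i\<close> and
  \<open>M * k\<close> lie in \<open>{row i..<k}\<close>, so the depth has not risen at
  \<open>M * k\<close>. For smaller \<open>k'\<close>, all values from \<open>row i\<close> to
  \<open>k'\<close> first occur after \<open>i\<close>, since an earlier occurrence would bound
  \<open>b ! i\<close>; so the depth has risen at \<open>M * k'\<close>.\<close>

lemma value_from_depth:
  assumes b: "b \<in> T" and i: "i \<in> {1..M * n}"
  shows "b ! i = (LEAST k. row i \<le> k \<and> depth (initials b) (M * k) \<le> depth (initials b) i)"
proof (rule sym, rule Least_equality)
  define k where "k = b ! i"
  let ?S = "initials b"
  have ck: "row i \<le> k" using T_row[OF b] i k_def by simp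
  have iMk: "i \<le> M * k" using ck row_le_iff by simp
  have kn: "M * k \<le> M * n" using T_val_le[OF b] i k_def by simp
  have "(!) b ` (?S \<inter> {i<..M * k}) \<subseteq> {row i..<k}"
  proof
    fix v assume "v \<in> (!) b ` (?S \<inter> {i<..M * k})"
    then obtain p where p: "first_occ b p" "i < p" "p \<le> M * k" "v = b ! p" unfolding initials_def by auto
    have "b ! p \<le> k" using T_nest[OF b, of i p] p i k_def by simp
    moreover have "b ! p \<noteq> k" using p k_def unfolding first_occ_def by metis
    moreover have "row i \<le> b ! p" using T_row[OF b, of p] row_mono[of i p] p kn by simp
    ultimately show "v \<in> {row i..<k}" using p by simp
  qed
  then have "card ((!) b ` (?S \<inter> {i<..M * k})) \<le> k - row i"
    using card_mono[of "{row i..<k}"] by (metis finite_atLeastLessThan card_atLeastLessThan)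
  moreover have "card ((!) b ` (?S \<inter> {i<..M * k})) = card (?S \<inter> {i<..M * k})"
    by (intro card_image inj_on_subset[OF initials_inj]) auto
  ultimately have "card (?S \<inter> {i<..M * k}) \<le> k - row i" by simp
  then show "row i \<le> b ! i \<and> depth ?S (M * b ! i) \<le> depth ?S i"
    using ck card_split[OF iMk, of ?S] unfolding depth_def k_def[symmetric] by (simp add: of_nat_diff)
  fix k' assume k': "row i \<le> k' \<and> depth ?S (M * k') \<le> depth ?S i"
  show "b ! i \<le> k'"
  proof (rule ccontr)
    assume "\<not> b ! i \<le> k'"
    then have lt: "k' < k" using k_def by simp
    have "{row i..k'} \<subseteq> (!) b ` (?S \<inter> {i<..M * k'})"
    proof
      fix v assume v: "v \<in> {row i..k'}"
      have "1 \<le> v" "v \<le> n" using v row_pos[of i] i lt T_upper[OF b, of i] k_def by auto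
      then obtain p where p: "p \<in> ?S" "b ! p = v" "p \<le> M * v" using first_occ_exists[OF b] by blast
      have "M * v \<le> M * k'" using v by simp
      then have "p \<le> M * k'" using p by linarith
      moreover have "i < p"
      proof (rule ccontr)
        assume "\<not> i < p"
        moreover have "i \<le> M * v" using v row_le_iff by simp
        ultimately have "b ! i \<le> v" using T_nest_le[OF b, of p i] p i by simp
        then show False using v lt k_def by simp
      qed
      ultimately have "p \<in> ?S \<inter> {i<..M * k'}" using p by simp
      then show "v \<in> (!) b ` (?S \<inter> {i<..M * k'})" using p by blast
    qed
    then have "card {row i..k'} \<le> card (?S \<inter> {i<..M * k'})"
      by (meson card_image_le card_mono finite_Int finite_greaterThanAtMost finite_imageI le_trans)
    moreover have "i \<le> M * k'" using k' row_le_iff by simp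
    moreover have "card {row i..k'} + row i = k' + 1" using k' by simp
    ultimately show False using k' card_split[of i "M * k'" ?S] unfolding depth_def row_mult by linarith
  qed
qed

lemma initials_inject:
  assumes b: "b \<in> T" "b' \<in> T" and e: "initials b = initials b'" shows "b = b'"
proof (rule T_eqI[OF b])
  fix i assume i: "i \<le> M * n"
  show "b ! i = b' ! i"
  proof (cases "i = 0")
    case True
    then show ?thesis using T_mult[OF b(1), of 0] T_mult[OF b(2), of 0] by simp
  next
    case False
    then show ?thesis using value_from_depth[OF b(1), of i] value_from_depth[OF b(2), of i] e i by simp
  qed
qed

lemma Psi_inj: "inj_on (Psi m n) T"
proof (rule inj_onI)
  fix b b' assume b: "b \<in> T" "b' \<in> T" and e: "Psi m n b = Psi m n b'"
  have "initials b = initials b'" unfolding initials_openers[OF b(1)] initials_openers[OF b(2)] e ..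
  then show "b = b'" using initials_inject[OF b] by blast
qed

text \<open>The formula of \<open>value_from_depth\<close> is taken as the definition of the vector.
  Both sets have \<open>n\<close> elements, so it is enough that every first occurrence lies in
  \<open>S\<close>.\<close>

lemma ballot_realised:
  assumes S: "S \<subseteq> {1..M * n}" "card S = n"
    and ballot: "\<And>j. j \<in> {1..M * n} \<Longrightarrow> row j \<le> card (S \<inter> {1..j})"
  obtains b where "b \<in> T" "initials b = S"
proof -
  define c where "c j = card (S \<inter> {1..j})" for j
  define d where "d = depth S"
  have d: "d j = int (c j) - int (row j)" for j unfolding d_def depth_def c_def ..
  have cl0: "row 0 = 0" using row_mult[of 0] by simp
  have d0: "d 0 = 0" unfolding d c_def using cl0 by simp
  have cn: "c (M * n) = n" unfolding c_def using S by (simp add: Int_absorb2)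
  have dn: "d (M * n) = 0" unfolding d cn by simp
  have dpos: "0 \<le> d j" if "j \<le> M * n" for j
  proof (cases "j = 0")
    case False
    then show ?thesis using ballot[of j] that unfolding d c_def by simp
  qed (simp add: d0)
  have c_mono: "c i \<le> c j" if "i \<le> j" for i j
    unfolding c_def using that by (intro card_mono) auto
  have c_Suc: "c (j + 1) = (if j + 1 \<in> S then c j + 1 else c j)" for j
  proof -
    have "{j<..j + 1} = {j + 1}" by auto
    then have "S \<inter> {j<..j + 1} = (if j + 1 \<in> S then {j + 1} else {})" by auto
    then show ?thesis using card_split[of j "j + 1" S] unfolding c_def by simp
  qed
  have S1: "1 \<in> S"
  proof (rule ccontr)
    assume "1 \<notin> S"
    then have "S \<inter> {1..1} = {}" by auto
    then show False using ballot[of 1] row_pos[of 1] len_pos by simp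
  qed
  define f where "f i = (LEAST k. row i \<le> k \<and> d (M * k) \<le> d i)" for i
  have fP: "row i \<le> f i \<and> d (M * f i) \<le> d i" and f_n: "f i \<le> n" if "i \<le> M * n" for i
  proof -
    have Q: "row i \<le> n \<and> d (M * n) \<le> d i" using dn dpos that row_le_iff by simp
    show "row i \<le> f i \<and> d (M * f i) \<le> d i" unfolding f_def by (rule LeastI, rule Q)
    show "f i \<le> n" unfolding f_def by (rule Least_le, rule Q)
  qed
  have f_le: "f i \<le> k" if "row i \<le> k" "d (M * k) \<le> d i" for i k
    unfolding f_def using that by (intro Least_le) simp
  have f_nest: "f j \<le> f i" if i: "i \<le> M * n" and ij: "i < j" "j \<le> M * f i" for i j
  proof (rule f_le)
    show cj: "row j \<le> f i" using ij row_le_iff by simp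
    show "d (M * f i) \<le> d j"
    proof (rule ccontr)
      assume neg: "\<not> d (M * f i) \<le> d j"
      then have lt: "d j < d (M * f i)" "d (M * f i) \<le> d i" using fP[OF i] by auto
      define k where "k = row j - 1"
      have ck: "row j = k + 1" unfolding k_def using row_pos[of j] ij by simp
      show False
      proof (cases "i \<le> M * k")
        case False
        have "row i = row j" using False row_eq_iff[of i k] row_eq_iff[of j k] ck ij by simp
        then show False using lt c_mono[of i j] ij unfolding d by simp
      next
        case True
        \<comment> \<open>From \<open>M * k\<close> to a position of the next row the depth drops by
          at most one, so at \<open>M * k\<close> it is already at most \<open>d (M * f i)\<close>,
          hence at most \<open>d i\<close>; minimality gives \<open>f i \<le> k\<close>.\<close>
        have "M * k < j" using ck row_eq_iff by simp
        then have "d (M * k) \<le> d j + 1" using c_mono[of "M * k" j] ck unfolding d row_mult by simp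
        then have "f i \<le> k" using f_le[of i k] lt True row_le_iff by simp
        then show False using cj ck by simp
      qed
    qed
  qed
  define b where "b = map f [0..<M * n + 1]"
  have nb: "b ! i = f i" if "i \<le> M * n" for i
    unfolding b_def using that by (subst nth_map) (auto simp del: upt_Suc)
  have bT: "b \<in> T" unfolding T_iff
  proof (intro conjI allI impI)
    show "length b = M * n + 1" unfolding b_def by simp
    show "b ! (M * k) = k" if "k \<le> n" for k
    proof -
      have "M * k \<le> M * n" using that by simp
      then show ?thesis using nb[of "M * k"] fP[of "M * k"] f_le[of "M * k" k] by simp
    qed
    show "i \<le> M * b ! i" if "i \<le> M * n" for i using nb[OF that] fP[OF that] row_le_iff by simp
    show "b ! i \<le> n" if "i \<le> M * n" for i using nb[OF that] f_n[OF that] by simp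
    fix i j assume H: "i < j \<and> j \<le> M * b ! i \<and> i \<le> M * n"
    then have i: "i \<le> M * n" "i < j" "j \<le> M * f i" using nb[of i] by auto
    then have "j \<le> M * n" using f_n[OF i(1)] mult_le_mono2[of "f i" n M] by linarith
    then show "b ! j \<le> b ! i" using nb i f_nest by simp
  qed
  have "initials b \<subseteq> S"
  proof (rule subsetI, rule ccontr)
    fix i assume i: "i \<in> initials b" and iS: "i \<notin> S"
    have il: "1 \<le> i" "i \<le> M * n" "first_occ b i" using i unfolding initials_def by auto
    then have "i \<noteq> 1" using iS S1 by auto
    define p where "p = i - 1"
    have p: "i = p + 1" "1 \<le> p" "p \<le> M * n" using il \<open>i \<noteq> 1\<close> unfolding p_def by auto
    have ci: "c i = c p" using c_Suc[of p] iS p by simp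
    obtain j where j: "j < i" "f j = f i"
    proof (cases "M dvd p")
      case False
      then have "row i = row p" using row_Suc_not_mult p by simp
      then have "f p = f i" unfolding f_def d ci by simp
      then show ?thesis using that[of p] p by simp
    next
      case True
      then have cli: "row i = row p + 1" using row_Suc_mult p by simp
      have di: "d i = d p - 1" unfolding d ci cli by simp
      \<comment> \<open>\<open>j\<close> is the last position up to \<open>p\<close> of depth at
        most \<open>d i\<close>; position 0 qualifies. The depth rises right after \<open>j\<close>,
        so \<open>j\<close> is not a multiple of \<open>M\<close> and has depth exactly
        \<open>d i\<close>; up to \<open>p\<close> it stays above \<open>d i\<close>, so no row end
        there can be \<open>M * f j\<close>. Hence \<open>f j = f i\<close>.\<close>
      let ?Q = "\<lambda>j. j \<le> p \<and> d j \<le> d i"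
      define j where "j = Greatest ?Q"
      have Q0: "?Q 0" using d0 dpos[OF il(2)] by simp
      have Qj: "?Q j" unfolding j_def by (rule GreatestI_nat[of ?Q 0 p]) (use Q0 in auto)
      have jmax: "d i < d k" if "j < k" "k \<le> p" for k
      proof (rule ccontr)
        assume "\<not> d i < d k"
        then have "k \<le> j" unfolding j_def by (intro Greatest_le_nat[of ?Q k p]) (use that in auto)
        then show False using that by simp
      qed
      have jp: "j < p" using Qj di by (cases "j = p") auto
      then have j1: "d i < d (j + 1)" using jmax[of "j + 1"] by simp
      have nd: "\<not> M dvd j"
      proof
        assume "M dvd j"
        then have "row (j + 1) = row j + 1" by (rule row_Suc_mult)
        then have "d (j + 1) \<le> d j" unfolding d using c_Suc[of j] by simp
        then show False using j1 Qj by simp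
      qed
      have "d (j + 1) \<le> d j + 1" unfolding d row_Suc_not_mult[OF nd] using c_Suc[of j] by simp
      then have dj: "d j = d i" using j1 Qj by simp
      have jl: "j \<le> M * n" using jp p by simp
      have "row i \<le> f j"
      proof (rule ccontr)
        assume "\<not> row i \<le> f j"
        then have "f j \<le> row p" using cli by simp
        then have "M * f j \<le> p" using True by (metis row_mult dvdE mult_le_mono2)
        moreover have "j \<le> M * f j" using fP[OF jl] row_le_iff by simp
        then have "j < M * f j" using less_mult_if_not_dvd[OF nd] by simp
        ultimately have "d i < d (M * f j)" using jmax by simp
        then show False using fP[OF jl] dj by simp
      qed
      then have "f i \<le> f j" using f_le[of i "f j"] fP[OF jl] dj by simp
      moreover have "row j \<le> row i" using row_mono jp p by simp
      then have "f j \<le> f i" using f_le[of j "f i"] fP[OF il(2)] dj by simp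
      ultimately show ?thesis using that[of j] jp p by simp
    qed
    then have "b ! j = b ! i" using nb il by simp
    then show False using il(3) j unfolding first_occ_def by blast
  qed
  moreover have "finite S" using S finite_subset by blast
  ultimately have "initials b = S" using card_subset_eq S(2) card_initials[OF bT] by metis
  then show ?thesis using that bT by blast
qed

lemma Psi_surj:
  assumes P: "P \<in> ShNC m n"
  obtains b where "b \<in> T" "Psi m n b = P"
proof -
  define S where "S = insert 1 (Suc ` openers P)"
  have sub: "openers P \<subseteq> {1..<M * n}" using openers_subset P ShNC_shifted by blast
  then have fin: "finite (openers P)" using finite_subset by blast
  have S1: "S \<subseteq> {1..M * n}" unfolding S_def using sub len_pos by auto
  have split: "card (insert 1 (Suc ` X)) = card X + 1" if "finite X" "0 \<notin> X" for X
  proof -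
    have "1 \<notin> Suc ` X" using that by auto
    then show ?thesis using that by (simp add: card_image)
  qed
  have "0 \<notin> openers P" using sub by auto
  then have "card S = n" unfolding S_def using split[OF fin] ShNC_card_openers[OF P] n_pos by simp
  moreover have "row j \<le> card (S \<inter> {1..j})" if j: "j \<in> {1..M * n}" for j
  proof -
    have "S \<inter> {1..j} = insert 1 (Suc ` (openers P \<inter> {1..<j}))" unfolding S_def using j sub by auto
    then have "card (S \<inter> {1..j}) = card (openers P \<inter> {1..<j}) + 1" using split[of "openers P \<inter> {1..<j}"] by simp
    then show ?thesis using openers_ballot[OF P, of j] j by simp
  qed
  ultimately obtain b where b: "b \<in> T" "initials b = S" using ballot_realised[OF S1] by blast
  have "openers (Psi m n b) = openers P" unfolding openers_Psi[OF b(1)] b(2) S_def using sub by auto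
  then show ?thesis using that b ShNC_eqI[OF Psi_in_ShNC[OF b(1)] P] by blast
qed

lemma bij_Psi: "bij_betw (Psi m n) T (ShNC m n)"
  unfolding bij_betw_def using Psi_inj Psi_in_ShNC Psi_surj by blast

section \<open>Rotation\<close>

lemma inj_cyclic_pred: "inj_on (cyclic_pred (M * n)) {1..M * n}"
  by (rule inj_onI) (auto simp: cyclic_pred_def split: if_splits)

lemma image_cyclic_pred: "cyclic_pred (M * n) ` {1..M * n} = {1..M * n}"
  by (rule endo_inj_surj) (use len_pos inj_cyclic_pred in \<open>auto simp: cyclic_pred_def\<close>)

text \<open>Only 1 wraps around, to the largest position, so among \<open>p < q < r < s\<close> only
  \<open>s\<close> can come from it; its preimage then comes first, and the preimages match the
  reversed pattern in \<open>crossing\<close>.\<close>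

lemma Rot_noncrossing:
  assumes nc: "noncrossing P" and sub: "\<And>B. B \<in> P \<Longrightarrow> B \<subseteq> {1..M * n}"
  shows "noncrossing (Rot m n P)"
proof -
  let ?g = "cyclic_pred (M * n)"
  have no: "False" if B: "B \<in> P" "C \<in> P" "B \<noteq> C" and mem: "p \<in> ?g ` B" "q \<in> ?g ` C" "r \<in> ?g ` B" "s \<in> ?g ` C"
    and lt: "p < q" "q < r" "r < s" for B C p q r s
  proof -
    obtain p' q' r' s' where e: "p' \<in> B" "p = ?g p'" "q' \<in> C" "q = ?g q'" "r' \<in> B" "r = ?g r'" "s' \<in> C" "s = ?g s'"
      using mem by blast
    have range: "p' \<in> {1..M * n}" "q' \<in> {1..M * n}" "r' \<in> {1..M * n}" "s' \<in> {1..M * n}" using e sub B by blast+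
    have sn: "s \<le> M * n" using e range unfolding cyclic_pred_def by auto
    have "p' = p + 1" "q' = q + 1" "r' = r + 1" using e range lt sn unfolding cyclic_pred_def by (auto split: if_splits)
    moreover have "s' = s + 1 \<or> s' = 1" using e range unfolding cyclic_pred_def by auto
    ultimately have "p' < q' \<and> q' < r' \<and> r' < s' \<or> s' < p' \<and> p' < q' \<and> q' < r'"
      using lt e(2) range(1) len_pos(1) unfolding cyclic_pred_def by (auto split: if_splits)
    then have "crossing B C"
    proof
      assume "p' < q' \<and> q' < r' \<and> r' < s'"
      then show ?thesis unfolding crossing_def using e by blast
    next
      assume "s' < p' \<and> p' < q' \<and> q' < r'"
      then show ?thesis unfolding crossing_def using e by blast
    qed
    then show False using nc B unfolding noncrossing_def by blast
  qed
  show ?thesis unfolding noncrossing_def Rot_def m_plus_1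
  proof (intro ballI impI)
    fix B' C' assume "B' \<in> (`) ?g ` P" "C' \<in> (`) ?g ` P" "B' \<noteq> C'"
    then obtain B C where B: "B \<in> P" "C \<in> P" "B \<noteq> C" "B' = ?g ` B" "C' = ?g ` C" by blast
    show "\<not> crossing B' C'" unfolding crossing_def B(4,5)
      using no[OF B(1-3)] no[OF B(2,1) B(3)[symmetric]] by blast
  qed
qed

lemma Rot_in_ShNC:
  assumes P: "P \<in> ShNC m n" shows "Rot m n P \<in> ShNC m n"
proof -
  let ?g = "cyclic_pred (M * n)"
  have sh: "shifted P" "card P = m * n + 1" using P ShNC_shifted by auto
  have pt: "partition_on {1..M * n} P" using sh unfolding shifted_def by simp
  have sub: "B \<subseteq> {1..M * n}" if "B \<in> P" for B using shifted_subset[OF sh(1) that] .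
  have R: "Rot m n P = (`) ?g ` P" unfolding Rot_def m_plus_1 ..
  have ne: "{} \<notin> P" using partition_onD3[OF pt] .
  have "partition_on (?g ` {1..M * n}) ((`) ?g ` P - {{}})"
    using partition_on_inj_image[OF pt inj_cyclic_pred] .
  moreover have "(`) ?g ` P - {{}} = (`) ?g ` P" using ne by auto
  ultimately have ptR: "partition_on {1..M * n} (Rot m n P)" unfolding R image_cyclic_pred by simp
  have "inj_on ((`) ?g) P"
    by (rule inj_onI) (metis inj_on_image_eq_iff[OF inj_cyclic_pred] sub)
  then have cR: "card (Rot m n P) = m * n + 1" unfolding R using card_image sh by metis
  \<comment> \<open>For \<open>i = 1\<close> this holds because \<open>M\<close> divides
    \<open>M * n\<close>; so rotation keeps congruent positions congruent.\<close>
  have cong: "[?g i + 1 = i] (mod M)" if "i \<in> {1..M * n}" for i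
  proof (cases "i = 1")
    case True
    have "[M * n + 1 = 0 + 1] (mod M)" by (intro cong_add) (auto simp: cong_def)
    then show ?thesis using True unfolding cyclic_pred_def by simp
  qed (use that in \<open>simp add: cyclic_pred_def\<close>)
  have cg: "[i = j] (mod M)" if B: "B \<in> Rot m n P" "i \<in> B" "j \<in> B" for B i j
  proof -
    obtain C i' j' where C: "C \<in> P" "i' \<in> C" "j' \<in> C" "i = ?g i'" "j = ?g j'" using B unfolding R by blast
    have "[i' = j'] (mod M)" using sh C unfolding shifted_def by blast
    moreover have "[i + 1 = i'] (mod M)" "[j + 1 = j'] (mod M)" using cong C sub by blast+
    ultimately have "[i + 1 = j + 1] (mod M)" by (meson cong_sym cong_trans)
    then show ?thesis by (simp only: cong_add_rcancel_nat)
  qed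
  show ?thesis unfolding ShNC_shifted shifted_def
    using ptR cR cg Rot_noncrossing[of P] sh(1) sub unfolding shifted_def by blast
qed

text \<open>Put \<open>x = i + 1\<close>. Either \<open>x\<close> is an opener of \<open>P\<close>,
  and then a descent of \<open>z\<close> or a multiple of \<open>M\<close>; or \<open>x\<close> is
  the largest element of the block of 1, and then it is the first occurrence of \<open>n\<close> in
  \<open>y\<close>.\<close>

lemma rotated_initial:
  assumes z: "z \<in> T" and i: "i \<in> openers (Rot m n (Psi m n z))"
  shows "i + 1 \<in> initials (rowmotion L z)"
proof -
  define y where "y = rowmotion L z"
  have y: "y \<in> T" "ascents y = descents m n z" "\<And>i. i \<in> descents m n z \<Longrightarrow> gap z i (y ! i)"
    using rowmotion_spec[OF z] unfolding y_def by auto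
  let ?g = "cyclic_pred (M * n)"
  define P where "P = Psi m n z"
  note F = Psi_follows[OF z, folded P_def]
  have PS: "P \<in> ShNC m n" using Psi_in_ShNC[OF z] P_def by simp
  have sh: "shifted P" using PS ShNC_shifted by simp
  have pt: "partition_on {1..M * n} P" using sh unfolding shifted_def by simp
  obtain C where C: "C \<in> Rot m n P" "i \<in> C" "\<exists>x \<in> C. i < x" using i unfolding openers_def P_def by blast
  then obtain B where B: "B \<in> P" "C = ?g ` B" unfolding Rot_def m_plus_1 by blast
  have sub: "B \<subseteq> {1..M * n}" using shifted_subset[OF sh B(1)] .
  obtain x w where x: "x \<in> B" "i = ?g x" and w: "w \<in> B" "?g x < ?g w" using C B by blast
  have xl: "x \<in> {1..M * n}" "w \<in> {1..M * n}" using x w sub by auto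
  have "?g w \<le> M * n" using xl unfolding cyclic_pred_def by auto
  then have x1: "x \<noteq> 1" using w unfolding cyclic_pred_def by auto
  then have xi: "x = i + 1" using x xl unfolding cyclic_pred_def by auto
  have asc: "j \<in> descents m n z \<and> gap z j (y ! j)" if "j \<in> ascents y" for j using that y by blast
  have desc_initial: "first_occ y j" if "j \<in> descents m n z" for j
    using that y(2) unfolding ascents_def by blast
  have "first_occ y x"
  proof (cases "x \<in> openers P")
    case True
    then have xI: "x + 1 \<in> initials z" using openers_Psi[OF z] P_def by simp
    then have xn: "x < M * n" "first_occ z (x + 1)" unfolding initials_def by auto
    show ?thesis
    proof (cases "M dvd x")
      case False
      then have "x \<in> descents m n z" using descents_first_occ[OF z xn(1)] xn by simp
      then show ?thesis by (rule desc_initial)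
    next
      case True
      then obtain k where k: "x = M * k" by blast
      have "M * k < M * n" using xn(1) k by simp
      then have kn: "k < n" by simp
      have yx: "y ! x = k" using T_mult[OF y(1), of k] k kn by simp
      \<comment> \<open>An earlier occurrence of \<open>k\<close> would start at an ascent
        \<open>a\<close> of \<open>y\<close>, a descent of \<open>z\<close> with gap ending at
        \<open>M * k\<close>; then \<open>x + 1\<close> repeats the entry of \<open>z\<close> at
        \<open>a\<close>, although it is a first occurrence.\<close>
      have "y ! j \<noteq> k" if j: "j < x" for j
      proof
        assume yj: "y ! j = k"
        have jn: "j \<le> M * n" using j xn by simp
        have "\<not> M dvd j" using T_dvd[OF y(1) jn] yj j k by auto
        then obtain a where a: "a \<in> ascents y" "a \<le> j" "y ! a = k"
          using ascent_below[OF y(1) jn] yj kn by metis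
        then have "gap z a k" using asc by blast
        then have "z ! (x + 1) = z ! a" unfolding gap_def k by simp
        then show False using xn(2)[unfolded first_occ_def, rule_format, of a] a(2) j by simp
      qed
      then show ?thesis unfolding first_occ_def yx by blast
    qed
  next
    case False
    have xmax: "v \<le> x" if "v \<in> B" for v
      using False that x(1) B(1) unfolding openers_def by (auto simp: not_less[symmetric])
    have "\<not> x < w" using xmax[OF w(1)] by simp
    then have "w = 1" using w x1 xl unfolding cyclic_pred_def by (auto split: if_splits)
    then have oB: "1 \<in> B" using w by simp
    have x1': "1 < x" using x1 xl by simp
    \<comment> \<open>As \<open>M \<ge> 2\<close>, residue 1 is not 0, so all arcs in the block of 1
      start at descents and preserve the value.\<close>
    have reached: "v mod M = 1 \<and> z ! v = z ! 1 \<and> 1 \<le> v" if "(1, v) \<in> {(i, j). phi m n z i = Some j}\<^sup>*" for v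
      using that
    proof induction
      case base
      then show ?case using M_ge_2 by simp
    next
      case (step u v)
      then have pu: "phi m n z u = Some v" by simp
      have ul: "u \<in> {1..M * n}" using reach_follows[OF F B(1) oB step(1)] sub by blast
      show ?case using z ul pu
      proof (cases rule: phi_cases)
        case mult
        then show ?thesis using step.IH by simp
      next
        case descent
        note nc = next_cong_props[OF z descent(2), folded descent(3)]
        then show ?thesis using step.IH unfolding cong_def by simp
      qed
    qed
    have val: "v mod M = 1 \<and> z ! v = z ! 1" if "v \<in> B" for v
    proof -
      have "1 \<le> v" using that sub by auto
      then show ?thesis using reached[OF follows_reach[OF F B(1) oB that]] by blast
    qed
    have z1: "x \<le> M * z ! 1"
      using T_lower[OF z, of x] val[OF x(1)] xl by simp
    \<comment> \<open>A bar over \<open>x\<close> from some \<open>a < x\<close> would make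
      \<open>z ! a\<close> exceed \<open>z ! x = z ! 1\<close>, yet nesting bounds it by
      \<open>z ! 1\<close>; a bar starting at \<open>x\<close> would make \<open>x\<close> an
      opener.\<close>
    have uncovered: "False" if a: "a \<in> descents m n z" "a \<le> x" "x \<le> M * (y ! a)" for a
    proof (cases "a = x")
      case True
      have xn: "x < M * n" using descent_less[OF a(1)] True by simp
      then have "first_occ z (x + 1)"
        using a(1) True descents_first_occ[OF z xn] descent_not_dvd[OF z a(1)] by simp
      then have "x \<in> openers P" unfolding P_def openers_Psi[OF z] initials_def using xl xn by simp
      then show False using False by simp
    next
      case False
      then have "a < x" using a by simp
      then have lt: "z ! x < z ! a" using y(3)[OF a(1)] a(3) unfolding gap_def by blast
      have "1 \<le> a" using descent_not_dvd[OF z a(1)] by (cases a) auto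
      moreover have "z ! a \<le> z ! 1" using T_nest_le[OF z, of 1 a] calculation \<open>a < x\<close> z1 len_pos by simp
      ultimately show False using lt val[OF x(1)] by simp
    qed
    have ndx: "\<not> M dvd x" using val[OF x(1)] by auto
    have yx: "y ! x = n"
    proof (rule ccontr)
      assume "y ! x \<noteq> n"
      then have "y ! x < n" using T_upper[OF y(1), of x] xl by simp
      then obtain a where a: "a \<in> ascents y" "a \<le> x" "y ! a = y ! x"
        using ascent_below[OF y(1) _ ndx] xl by auto
      then show False using uncovered[of a] asc T_lower[OF y(1), of x] xl by simp
    qed
    have "y ! j \<noteq> n" if j: "j < x" for j
    proof (cases "M dvd j")
      case True
      then obtain k where k: "j = M * k" by blast
      have "j < M * n" using j xl(1) by auto
      then have "M * k < M * n" using k by simp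
      then show ?thesis using T_mult[OF y(1), of k] k by simp
    next
      case False
      then have "1 \<le> j" by (cases j) auto
      define u where "u = Max {u \<in> B. u \<le> j}"
      have "u \<in> {u \<in> B. u \<le> j}" unfolding u_def using oB \<open>1 \<le> j\<close> by (intro Max_in) auto
      then have u: "u \<in> B" "u \<le> j" by auto
      have umax: "v \<le> u" if "v \<in> B" "v \<le> j" for v unfolding u_def using that by (intro Max_ge) auto
      have ul: "u \<in> {1..M * n}" using u sub by blast
      have "\<not> (\<forall>w \<in> B. w \<le> u)" using x(1) u(2) j by (intro notI) fastforce
      then have "phi m n z u \<noteq> None" using F B(1) u(1) unfolding follows_def by blast
      then obtain v where v: "phi m n z u = Some v" by blast
      then have "is_successor B u v" using F B(1) u unfolding follows_def by blast
      then have vB: "v \<in> B" "u < v" "v \<le> x" unfolding is_successor_def using x(1) u j by auto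
      have jv: "j < v" using umax[OF vB(1)] vB(2) by (cases "v \<le> j") simp_all
      have ndu: "\<not> M dvd u" using val[OF u(1)] by auto
      then have d: "u \<in> descents m n z" "v = next_cong z u" using z ul v by (auto elim: phi_cases)
      have g: "gap z u (y ! u)" using y(3)[OF d(1)] .
      \<comment> \<open>Position \<open>M * (y ! u) + 1\<close> carries \<open>z ! u\<close> by the
        gap and has residue 1 like \<open>u\<close>, so the successor \<open>v\<close> lies no
        further right. Thus the bar of \<open>u\<close> covers everything before \<open>v\<close>,
        in particular \<open>j\<close>.\<close>
      have "v \<le> M * (y ! u) + 1"
      proof -
        have "u < M * (y ! u) + 1" "z ! (M * (y ! u) + 1) = z ! u" using g unfolding gap_def by auto
        moreover have "y ! u < n" using g T_upper[OF z, of u] ul unfolding gap_def by simp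
        then have "M * (y ! u) + 1 \<le> M * n" by (rule mult_less_imp)
        moreover have "(M * (y ! u) + 1) mod M = 1" using M_ge_2 by (simp only: mod_mult_self4) simp
        then have "[M * (y ! u) + 1 = u] (mod M)" using val[OF u(1)] unfolding cong_def by simp
        ultimately show ?thesis using next_cong_props(5)[OF z d(1), of "M * (y ! u) + 1"] d(2) by simp
      qed
      then have "j \<le> M * (y ! u)" using jv by simp
      then have "y ! j \<le> y ! u" using T_nest_le[OF y(1), of u j] ul u by simp
      moreover have "y ! u < n" using g T_upper[OF z, of u] ul unfolding gap_def by simp
      ultimately show ?thesis by simp
    qed
    then show ?thesis unfolding first_occ_def yx by blast
  qed
  then show ?thesis using xi xl unfolding initials_def y_def by simp
qed

lemma Psi_rowmotion:
  assumes z: "z \<in> T"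
  shows "Psi m n (rowmotion L z) = Rot m n (Psi m n z)"
proof -
  have y: "rowmotion L z \<in> T" using rowmotion_spec[OF z] by simp
  have R: "Rot m n (Psi m n z) \<in> ShNC m n" using Rot_in_ShNC Psi_in_ShNC[OF z] by blast
  have Y: "Psi m n (rowmotion L z) \<in> ShNC m n" using Psi_in_ShNC[OF y] .
  have "openers (Rot m n (Psi m n z)) \<subseteq> openers (Psi m n (rowmotion L z))"
  proof
    fix i assume i: "i \<in> openers (Rot m n (Psi m n z))"
    have "1 \<le> i" using openers_subset[of "Rot m n (Psi m n z)"] i R ShNC_shifted by auto
    then show "i \<in> openers (Psi m n (rowmotion L z))" unfolding openers_Psi[OF y]
      using rotated_initial[OF z i] by simp
  qed
  moreover have "finite (openers (Psi m n (rowmotion L z)))"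
    using openers_subset Y ShNC_shifted finite_subset by blast
  ultimately have "openers (Rot m n (Psi m n z)) = openers (Psi m n (rowmotion L z))"
    using card_subset_eq ShNC_card_openers[OF R] ShNC_card_openers[OF Y] by metis
  then show ?thesis using ShNC_eqI[OF Y R] by simp
qed

end

theorem theorem5p12:
  fixes m n :: nat
  assumes "m \<ge> 1" and "n \<ge> 1"
  shows "bij_betw (Psi m n) (tamari_vectors m n) (ShNC m n) \<and>
    (\<forall>b \<in> tamari_vectors m n.
       Psi m n (rowmotion (tamari_lattice m n) b) = Rot m n (Psi m n b))"
proof -
  interpret tamari m n "m + 1"
    by unfold_locales (use assms in auto)
  show ?thesis using bij_Psi Psi_rowmotion by blast
qed

end
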